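(* Let $k \geq 2$ be a natural number. There exist constants $\eta_k \in (0,1)$ (depending only on $k$) and $c_{s,k} > 0$ (depending only on $s,k$) such that the following holds. Let $\mathcal{I} \subseteq \mathbb{R}$ be an interval and let $f : \mathcal{I} \to \mathbb{R}$ be $(k-1)$-convex on $\mathcal{I}$. Then for every $s \in \mathbb{N}$ and every finite non-empty $I \subseteq \mathcal{I}$, writing $A = f(I)$ and $K = |2I - I|/|I|$, we have \[ E_s(A) \ll_{s,k} |A|^{2s - k + (4k-4) s^{-\eta_k}} + K^{c_{s,k}}. \]
   Context: A function $f$ is $(k-1)$-convex on an interval $\mathcal{I}$ if the derivatives $f^{(1)}, \dots, f^{(k)}$ all exist and are non-vanishing on $\mathcal{I}$. For a finite set $I$, $f(I) = \{f(i) : i \in I\}$ and $2I - I = \{i_1 + i_2 - i_3 : i_1, i_2, i_3 \in I\}$. For a finite set $X$ of reals and $t \in \mathbb{N}$, $E_t(X) = |\{(x_1,\dots,x_{2t}) \in X^{2t} : x_1 + \dots + x_t = x_{t+1} + \dots + x_{2t}\}|$. The notation $X \ll_z Y$ means $|X| \leq C_z|Y|$ for a positive constant $C_z$ depending only on $z$. *)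

theory Defs
  imports "HOL-Analysis.Analysis"
begin

text \<open>(k-1)-convexity on a set J: the derivatives f^(1),...,f^(k) exist on J
  (taken within J, i.e. one-sided at endpoints) and are non-vanishing on J.
  D j stands for the j-th derivative f^(j).\<close>
definition kconvex_on :: "nat \<Rightarrow> real set \<Rightarrow> (real \<Rightarrow> real) \<Rightarrow> bool" where
  "kconvex_on k J f \<longleftrightarrow>
     (\<exists>D :: nat \<Rightarrow> real \<Rightarrow> real.
        (\<forall>x\<in>J. D 0 x = f x) \<and>
        (\<forall>j<k. \<forall>x\<in>J. (D j has_real_derivative D (Suc j) x) (at x within J)) \<and>
        (\<forall>j\<in>{1..k}. \<forall>x\<in>J. D j x \<noteq> 0))"

definition two_minus :: "real set \<Rightarrow> real set" where
  "two_minus I = {a + b - c | a b c. a \<in> I \<and> b \<in> I \<and> c \<in> I}"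

definition energy :: "nat \<Rightarrow> real set \<Rightarrow> nat" where
  "energy t X = card {xs. length xs = 2 * t \<and> set xs \<subseteq> X \<and>
                          sum_list (take t xs) = sum_list (drop t xs)}"

end

theory Submission
  imports Defs
begin

text \<open>
  Let \<open>N = |A|\<close>, \<open>q t = E\<^sub>t(A) / N\<^bsup>2t\<^esup>\<close> and \<open>X t = q t * N\<^bsup>k\<^esup>\<close>, so that \<open>X 1 = N\<^bsup>k-1\<^esup>\<close> and \<open>X\<close> is decreasing. If \<open>q (2t)\<close>
  is not much smaller than \<open>q t\<close>, the Balog--Szemeredi--Gowers argument applied to the distribution of
  random sums of \<open>t\<close> elements of \<open>A\<close> yields a large \<open>A' \<subseteq> A\<close> for which \<open>m(A' - A')\<close> has not much more than
  \<open>1 / q t\<close> elements. On the other hand \<open>A'\<close> is the image of a large subset of \<open>I\<close>, which inherits small doubling,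
  and higher convexity forces \<open>m(A' - A')\<close> to have almost \<open>N\<^bsup>k\<^esup>\<close> elements. Together,
  \<open>X (2t) \<le> C * K\<^bsup>p\<^esup> * (X t) powr \<theta>\<close> with \<open>\<theta> < 1\<close> depending only on \<open>k\<close>. Iterating this along powers of two gives
  the bound with \<open>\<eta> = - log 2 \<theta>\<close>, unless \<open>K\<close> exceeds a fixed power of \<open>N\<close>, in which case \<open>N\<^bsup>2s\<^esup>\<close> is itself at
  most a power of \<open>K\<close>.
\<close>

section \<open>Iterated difference sets of images of convex functions\<close>

text \<open>Convexity is spent one order at a time. If \<open>h\<close> is the distance between many
  pairs of consecutive elements of \<open>I\<close>, then \<open>f (x + h) - f x\<close> has one
  order of convexity less, so by induction its values have an iterated difference set of size almost
  \<open>N ^ (k - 1)\<close>. A fixed share of that set fits into an interval no longer than the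
  increments of \<open>f\<close> across the remaining gaps, and the values of \<open>f\<close> at
  those gaps translate it to disjoint copies, which gains a factor of almost \<open>N\<close>.

  The quantity \<open>2I - I\<close> serves twice. If it is small, some gap length is popular; and
  since \<open>2I' - I'\<close> lies in \<open>2I - I\<close>, a subset \<open>I'\<close> of density
  \<open>1 / L\<close> loses only a factor \<open>L\<close> in the doubling. This inheritance is
  needed both for the half of the gaps on which the induction runs and for the preimage of
  \<open>A'\<close>.

  All losses must be polynomial in \<open>K\<close> and in \<open>L = q t / q (2t)\<close>. An
  inequality \<open>X t \<le> C * K ^ p * L ^ q\<close>, with a fixed exponent \<open>q\<close> in
  place of the function \<open>q t\<close>, can then be solved for \<open>X (2t)\<close> and gives
  \<open>\<theta> = 1 - 1 / q\<close>; the size of \<open>q\<close> is irrelevant.\<close>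

text \<open>This is \<open>mX - mX\<close>. Equally many plus and minus terms make it invariant
  under translations of \<open>X\<close>, which matters because random sums locate a structured part
  of \<open>A\<close> only up to a shift.\<close>

primrec diffs :: "nat \<Rightarrow> 'a::ab_group_add set \<Rightarrow> 'a set" where
  "diffs 0 X = {0}"
| "diffs (Suc m) X = {p + a - b | p a b. p \<in> diffs m X \<and> a \<in> X \<and> b \<in> X}"

lemma finite_diffs:
  assumes "finite X"
  shows "finite (diffs m X)"
proof (induction m)
  case (Suc m)
  have "diffs (Suc m) X = (\<lambda>(p, a, b). p + a - b) ` (diffs m X \<times> X \<times> X)"
    by (auto simp: image_iff) metis
  then show ?case
    using Suc assms by simp
qed simp

lemma zero_in_diffs:
  assumes "a \<in> X"
  shows "0 \<in> diffs m X"
proof (induction m)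
  case (Suc m)
  have "0 = 0 + a - a" by simp
  then show ?case
    using assms Suc unfolding diffs.simps by blast
qed simp

text \<open>A difference of two values of \<open>a - b\<close> equals
  \<open>(a x - b x) + (b y - a y)\<close>, hence two differences from \<open>X\<close>.\<close>

lemma diffs_forward_difference:
  assumes "\<And>x. x \<in> U \<Longrightarrow> a x \<in> X \<and> b x \<in> X"
  shows "diffs m ((\<lambda>x. a x - b x) ` U) \<subseteq> diffs (2 * m) X"
proof (induction m)
  case (Suc m)
  show ?case
  proof
    fix v
    assume "v \<in> diffs (Suc m) ((\<lambda>x. a x - b x) ` U)"
    then obtain p x y where v: "v = p + (a x - b x) - (a y - b y)"
      and p: "p \<in> diffs m ((\<lambda>x. a x - b x) ` U)" and xy: "x \<in> U" "y \<in> U"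
      by auto
    have "p + a x - b x \<in> diffs (Suc (2 * m)) X"
      using p Suc assms[OF xy(1)] by auto
    then have "(p + a x - b x) + b y - a y \<in> diffs (Suc (Suc (2 * m))) X"
      using assms[OF xy(2)] unfolding diffs.simps(2)[of "Suc (2 * m)"] by blast
    moreover have "(p + a x - b x) + b y - a y = v"
      using v by (simp add: algebra_simps)
    ultimately show "v \<in> diffs (2 * Suc m) X"
      by simp
  qed
qed simp

lemma card_diffs_pos:
  assumes "finite X" "X \<noteq> {}"
  shows "card (diffs m X) \<ge> 1"
proof -
  have "diffs m X \<noteq> {}"
    using assms zero_in_diffs by fastforce
  then show ?thesis
    using finite_diffs[OF assms(1)] by (simp add: Suc_leI card_gt_0_iff)
qed

section \<open>Gaps of finite sets of reals\<close>

lemma finite_two_minus: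
  assumes "finite I"
  shows "finite (two_minus I)"
proof -
  have "two_minus I = (\<lambda>(a, b, c). a + b - c) ` (I \<times> I \<times> I)"
    unfolding two_minus_def by (auto simp: image_iff) metis
  then show ?thesis
    using assms by simp
qed

lemma two_minus_mono: "X \<subseteq> Y \<Longrightarrow> two_minus X \<subseteq> two_minus Y"
  unfolding two_minus_def by blast

lemma subset_two_minus: "I \<subseteq> two_minus I"
  unfolding two_minus_def by force

lemma card_two_minus_ge:
  assumes "finite I"
  shows "card I \<le> card (two_minus I)"
  using assms by (simp add: card_mono finite_two_minus subset_two_minus)

text \<open>\<open>V\<close> grows by a lightest remaining point. It serves to separate the gaps
  across which \<open>f\<close> changes little from those across which it changes more.\<close>

lemma split_by_weight:
  fixes w :: "'a \<Rightarrow> real"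
  assumes "finite U" "n \<le> card U"
  shows "\<exists>V\<subseteq>U. card V = n \<and> (\<forall>x\<in>V. \<forall>y\<in>U - V. w x \<le> w y)"
  using assms(2)
proof (induction n)
  case 0
  then show ?case by (intro exI[of _ "{}"]) auto
next
  case (Suc n)
  then obtain V where V: "V \<subseteq> U" "card V = n" "\<forall>x\<in>V. \<forall>y\<in>U - V. w x \<le> w y"
    by auto
  have ne: "U - V \<noteq> {}"
    using V Suc.prems by (metis Diff_eq_empty_iff not_less_eq_eq order_refl subset_antisym)
  obtain z where z: "z \<in> U - V" "\<forall>y\<in>U - V. w z \<le> w y"
    using ex_is_arg_min_if_finite[OF finite_Diff[OF assms(1)] ne, of w]
    by (fastforce simp: is_arg_min_def)
  have "card (insert z V) = Suc n"
    using z V assms(1) finite_subset by fastforce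
  then show ?case
    using V z by (intro exI[of _ "insert z V"]) auto
qed

text \<open>Translates of a set with all distances below \<open>g\<close> by
  \<open>g\<close>-separated points are disjoint, so addition is injective on
  \<open>F \<times> V\<close>.\<close>

lemma card_mult_le_if_separated:
  fixes F V :: "real set"
  assumes sep: "\<And>x y. x \<in> F \<Longrightarrow> y \<in> F \<Longrightarrow> x \<noteq> y \<Longrightarrow> g \<le> \<bar>x - y\<bar>"
    and close: "\<And>v w. v \<in> V \<Longrightarrow> w \<in> V \<Longrightarrow> \<bar>v - w\<bar> < g"
    and sub: "\<And>x v. x \<in> F \<Longrightarrow> v \<in> V \<Longrightarrow> x + v \<in> T" and "finite T"
  shows "card F * card V \<le> card T"
proof -
  have "inj_on (\<lambda>(x, v). x + v) (F \<times> V)"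
  proof (rule inj_onI, clarify)
    fix x v y w
    assume *: "x \<in> F" "v \<in> V" "y \<in> F" "w \<in> V" "x + v = y + w"
    then have "\<bar>x - y\<bar> = \<bar>v - w\<bar>" by linarith
    then show "x = y \<and> v = w"
      using sep[OF *(1,3)] close[OF *(2,4)] *(5) by fastforce
  qed
  then have "card (F \<times> V) \<le> card T"
    using sub \<open>finite T\<close> by (intro card_inj_on_le) auto
  then show ?thesis
    by (simp add: card_cartesian_product)
qed

lemma sum_card_disjoint_le:
  assumes "finite T" "finite H" "\<And>u. u \<in> H \<Longrightarrow> B u \<subseteq> T"
    and "\<And>u v. u \<in> H \<Longrightarrow> v \<in> H \<Longrightarrow> u \<noteq> v \<Longrightarrow> B u \<inter> B v = {}"
  shows "(\<Sum>u\<in>H. card (B u)) \<le> card T"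
proof -
  have "(\<Sum>u\<in>H. card (B u)) = card (\<Union> (B ` H))"
    using assms by (intro card_UN_disjoint[symmetric]) (auto intro: finite_subset)
  also have "\<dots> \<le> card T"
    using assms by (intro card_mono) auto
  finally show ?thesis .
qed

text \<open>If the gap after \<open>u\<close> contains few elements of \<open>2I - I\<close>, then few distinct gaps are shorter,
  because adding each of them to \<open>u\<close> gives such an element. Take \<open>u\<close> with the longest gap among the
  at least \<open>(|I| - 1)/2\<close> points whose gap contains at most twice the average.\<close>

lemma popular_gap:
  fixes I :: "real set"
  assumes fin: "finite I" and two: "card I \<ge> 2"
  obtains h U where "h > 0" "U \<subseteq> I" "\<And>u. u \<in> U \<Longrightarrow> u + h \<in> I"
    "\<And>u x. u \<in> U \<Longrightarrow> x \<in> I \<Longrightarrow> u < x \<Longrightarrow> u + h \<le> x"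
    "card I ^ 2 \<le> 16 * card (two_minus I) * card U"
proof -
  define I' where "I' = I - {Max I}"
  define gap where "gap u = Min {x\<in>I. u < x} - u" for u
  have finI': "finite I'" using fin by (simp add: I'_def)
  have cI': "card I' = card I - 1"
    using fin two by (subst I'_def, subst card_Diff_singleton) (auto intro!: Max_in)
  have ne: "{x\<in>I. u < x} \<noteq> {}" if "u \<in> I'" for u
  proof -
    have "u < Max I" "Max I \<in> I"
      using that fin Max_in[of I] Max_ge[of I u] by (fastforce simp: I'_def less_le)+
    then show ?thesis by blast
  qed
  have gap_in: "u + gap u \<in> I \<and> gap u > 0" if "u \<in> I'" for u
    using Min_in[OF _ ne[OF that]] fin by (auto simp: gap_def)
  have gap_le: "u + gap u \<le> x" if "u \<in> I'" "x \<in> I" "u < x" for u x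
    using that fin by (auto simp: gap_def)
  \<comment> \<open>The part of \<open>2I - I\<close> in the half-open gap after \<open>u\<close>.
    These windows are disjoint, so their average size is at most
    \<open>|2I - I| / |I'|\<close>.\<close>
  define B where "B u = {y\<in>two_minus I. u < y \<and> y \<le> u + gap u}" for u
  have fin2: "finite (two_minus I)" using finite_two_minus fin by blast
  have disj: "B u \<inter> B v = {}" if "u \<in> I'" "v \<in> I'" "u \<noteq> v" for u v
  proof -
    have "u \<in> I" "v \<in> I" using that by (auto simp: I'_def)
    then show ?thesis
      using gap_le[OF that(1), of v] gap_le[OF that(2), of u] that(3)
      by (fastforce simp: B_def)
  qed
  have sumB: "(\<Sum>u\<in>I'. card (B u)) \<le> card (two_minus I)"
    by (rule sum_card_disjoint_le) (use fin2 finI' disj in \<open>auto simp: B_def\<close>)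
  define M where "M = card (two_minus I)"
  define n where "n = card I'"
  have n1: "n \<ge> 1" using cI' two by (simp add: n_def)
  \<comment> \<open>By Markov's inequality at least half of the gaps contain at most twice the
    average.\<close>
  define H where "H = {u\<in>I'. n * card (B u) \<le> 2 * M}"
  have finH: "finite H" using finI' by (simp add: H_def)
  have "card (I' - H) * (2 * M) \<le> n * (\<Sum>u\<in>I' - H. card (B u))"
    unfolding sum_distrib_left card_eq_sum sum_distrib_right
    by (rule sum_mono) (auto simp: H_def mult.commute)
  also have "\<dots> \<le> n * M"
    using sumB sum_mono2[of I' "I' - H" "\<lambda>u. card (B u)"] finI'
    unfolding M_def by (intro mult_left_mono) auto
  finally have "2 * card (I' - H) * M \<le> n * M" by (simp add: mult_ac)
  moreover have "M > 0"
    using card_two_minus_ge[OF fin] two by (simp add: M_def)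
  ultimately have "2 * card (I' - H) \<le> n" by simp
  moreover have "card H + card (I' - H) = n"
    using card_Diff_subset[OF finH, of I'] card_mono[OF finI', of H] by (simp add: n_def H_def)
  ultimately have cH: "n \<le> 2 * card H" by simp
  then have "H \<noteq> {}" using n1 by auto
  then obtain v where v: "v \<in> H" "\<forall>u\<in>H. gap u \<le> gap v"
    using ex_is_arg_min_if_finite[OF finH, of "\<lambda>u. - gap u"] by (fastforce simp: is_arg_min_def)
  have HI: "H \<subseteq> I'" "I' \<subseteq> I" by (auto simp: H_def I'_def)
  have "(\<lambda>u. v + gap u) ` H \<subseteq> B v"
  proof
    fix y
    assume "y \<in> (\<lambda>u. v + gap u) ` H"
    then obtain u where u: "u \<in> H" "y = v + gap u" by blast
    have "v + (u + gap u) - u \<in> two_minus I"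
      unfolding two_minus_def using gap_in[of u] u HI v(1) by blast
    then show "y \<in> B v"
      using u v gap_in[of u] HI by (auto simp: B_def)
  qed
  moreover have "finite (B v)" using fin2 by (simp add: B_def)
  ultimately have "card ((\<lambda>u. v + gap u) ` H) \<le> card (B v)" by (rule card_mono[rotated])
  moreover have "card ((\<lambda>u. v + gap u) ` H) = card (gap ` H)"
    using card_image[of "(+) v" "gap ` H"] by (simp add: image_image)
  ultimately have cg: "card (gap ` H) \<le> card (B v)" by simp
  \<comment> \<open>The gaps in \<open>H\<close> have at most \<open>2 * M / n\<close> distinct
    lengths, so one length occurs at least \<open>n\<^sup>2 / (4 * M)\<close> times. Passing from
    \<open>n\<close> to \<open>|I| \<le> 2 * n\<close> turns the 4 into 16.\<close>
  obtain h where h: "h \<in> gap ` H" "card H \<le> card (gap -` {h} \<inter> H) * card (gap ` H)"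
    using pigeonhole_card[of gap H "gap ` H"] finH \<open>H \<noteq> {}\<close> by auto
  define U where "U = gap -` {h} \<inter> H"
  have UH: "U \<subseteq> H" "\<And>u. u \<in> U \<Longrightarrow> gap u = h" by (auto simp: U_def)
  have "n * n \<le> n * (2 * card H)" using cH by simp
  also have "\<dots> \<le> n * (2 * (card U * card (B v)))"
    using h(2) cg by (auto simp: U_def intro: order_trans mult_left_mono)
  also have "\<dots> = 2 * card U * (n * card (B v))" by simp
  also have "\<dots> \<le> 2 * card U * (2 * M)"
    using v(1) by (intro mult_left_mono) (auto simp: H_def)
  finally have nn: "n * n \<le> 4 * M * card U" by (simp add: mult_ac)
  have "card I \<le> 2 * n" using cI' two n_def by linarith
  then have "card I ^ 2 \<le> (2 * n) ^ 2" by (rule power_mono) simp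
  also have "\<dots> \<le> 16 * M * card U" using nn by (simp add: power2_eq_square)
  finally have "card I ^ 2 \<le> 16 * M * card U" .
  moreover have "h > 0" using h(1) gap_in HI by auto
  moreover have "u + h \<in> I" if "u \<in> U" for u using UH that gap_in HI by blast
  moreover have "u + h \<le> x" if "u \<in> U" "x \<in> I" "u < x" for u x
    using UH that gap_le HI by blast
  moreover have "U \<subseteq> I" using UH(1) HI by blast
  ultimately show ?thesis
    using that[of h U] unfolding M_def by presburger
qed

section \<open>Forward differences of convex functions\<close>

text \<open>Immediate from the mean value theorem; continuity of the derivative does not enter, so
  this applies to the highest derivative as well.\<close>

lemma nonzero_derivative_inj:
  fixes g g' :: "real \<Rightarrow> real"
  assumes "is_interval J" and der: "\<And>x. x \<in> J \<Longrightarrow> (g has_real_derivative g' x) (at x within J)"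
    and nz: "\<And>x. x \<in> J \<Longrightarrow> g' x \<noteq> 0"
  shows "inj_on g J"
proof (rule linorder_inj_onI)
  fix x y
  assume xy: "x < y" "x \<in> J" "y \<in> J"
  have sub: "{x..y} \<subseteq> J"
    using mem_is_interval_1_I[OF assms(1) xy(2,3)] by auto
  have der': "(g has_derivative (\<lambda>t. g' z * t)) (at z within {x..y})" if "x \<le> z" "z \<le> y" for z
    using der[of z] that sub unfolding has_field_derivative_def
    by (intro has_derivative_subset[OF _ sub]) auto
  obtain z where "z \<in> {x<..<y}" "g y - g x = g' z * (y - x)"
    using mvt_simple[OF xy(1) der'] by auto
  moreover from this have "z \<in> J" using sub by auto
  ultimately show "g x \<noteq> g y"
    using nz[of z] xy(1) by auto
qed auto

lemma kconvex_onE: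
  assumes "kconvex_on k J f"
  obtains D where "\<And>x. x \<in> J \<Longrightarrow> D 0 x = f x"
    and "\<And>j x. j < k \<Longrightarrow> x \<in> J \<Longrightarrow> (D j has_real_derivative D (Suc j) x) (at x within J)"
    and "\<And>j x. 1 \<le> j \<Longrightarrow> j \<le> k \<Longrightarrow> x \<in> J \<Longrightarrow> D j x \<noteq> 0"
  using assms unfolding kconvex_on_def by fastforce

lemma kconvex_on_continuous:
  assumes "kconvex_on k J f" "k \<ge> 1"
  shows "continuous_on J f"
proof -
  obtain D where D: "\<And>x. x \<in> J \<Longrightarrow> D 0 x = f x"
    "\<And>j x. j < k \<Longrightarrow> x \<in> J \<Longrightarrow> (D j has_real_derivative D (Suc j) x) (at x within J)"
    using assms(1) by (rule kconvex_onE) blast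
  have "continuous_on J (D 0)"
    using D(2)[of 0] assms(2) by (intro DERIV_continuous_on[where D = "D (Suc 0)"]) auto
  then show ?thesis
    using D(1) by (simp cong: continuous_on_cong)
qed

lemma kconvex_on_inj:
  assumes J: "is_interval J" and f: "kconvex_on k J f" and "k \<ge> 1"
  shows "inj_on f J"
proof -
  obtain D where D: "\<And>x. x \<in> J \<Longrightarrow> D 0 x = f x"
    "\<And>j x. j < k \<Longrightarrow> x \<in> J \<Longrightarrow> (D j has_real_derivative D (Suc j) x) (at x within J)"
    "\<And>j x. 1 \<le> j \<Longrightarrow> j \<le> k \<Longrightarrow> x \<in> J \<Longrightarrow> D j x \<noteq> 0"
    using f by (rule kconvex_onE) blast
  have "inj_on (D 0) J"
    using J D(2)[of 0] D(3)[of 1] \<open>k \<ge> 1\<close> by (intro nonzero_derivative_inj[where g' = "D 1"]) auto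
  then show ?thesis
    using D(1) by (simp cong: inj_on_cong)
qed

lemma is_interval_forward_shift:
  fixes J :: "real set"
  assumes "is_interval J"
  shows "is_interval {x\<in>J. x + h \<in> J}"
  unfolding is_interval_1
proof (intro ballI allI impI CollectI)
  fix a b x
  assume *: "a \<in> {x\<in>J. x + h \<in> J}" "b \<in> {x\<in>J. x + h \<in> J}" "a \<le> x \<and> x \<le> b"
  then have "a + h \<le> x + h \<and> x + h \<le> b + h" by simp
  then show "x \<in> J \<and> x + h \<in> J"
    using assms * unfolding is_interval_1 mem_Collect_eq by blast
qed

text \<open>The \<open>j\<close>-th derivative is \<open>D j (x + h) - D j x\<close>. It cannot
  vanish because \<open>D j\<close> is injective, its own derivative being nonzero; this is where
  one order of convexity is used up.\<close>

lemma kconvex_on_forward_difference: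
  assumes J: "is_interval J" and f: "kconvex_on (Suc k) J f" and "h \<noteq> 0"
  shows "kconvex_on k {x\<in>J. x + h \<in> J} (\<lambda>x. f (x + h) - f x)"
proof -
  obtain D where D: "\<And>x. x \<in> J \<Longrightarrow> D 0 x = f x"
    "\<And>j x. j < Suc k \<Longrightarrow> x \<in> J \<Longrightarrow> (D j has_real_derivative D (Suc j) x) (at x within J)"
    "\<And>j x. 1 \<le> j \<Longrightarrow> j \<le> Suc k \<Longrightarrow> x \<in> J \<Longrightarrow> D j x \<noteq> 0"
    using f by (rule kconvex_onE) blast
  define J' where "J' = {x\<in>J. x + h \<in> J}"
  have der: "((\<lambda>x. D j (x + h) - D j x) has_real_derivative D (Suc j) (x + h) - D (Suc j) x) (at x within J')"
    if "j < k" "x \<in> J'" for j x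
  proof -
    have "(D j has_real_derivative D (Suc j) (x + h)) (at (x + h) within (\<lambda>x. x + h) ` J')"
      by (rule DERIV_subset[OF D(2)]) (use that in \<open>auto simp: J'_def\<close>)
    then have "(D j \<circ> (\<lambda>x. x + h) has_real_derivative D (Suc j) (x + h) * 1) (at x within J')"
      by (rule DERIV_image_chain) (auto intro!: derivative_eq_intros)
    moreover have "(D j has_real_derivative D (Suc j) x) (at x within J')"
      by (rule DERIV_subset[OF D(2)]) (use that in \<open>auto simp: J'_def\<close>)
    ultimately show ?thesis
      by (auto simp: o_def intro!: DERIV_diff)
  qed
  have nz: "D j (x + h) - D j x \<noteq> 0" if "1 \<le> j" "j \<le> k" "x \<in> J'" for j x
  proof -
    have "inj_on (D j) J"
      using J D(2)[of j] D(3)[of "Suc j"] that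
      by (intro nonzero_derivative_inj[where g' = "D (Suc j)"]) auto
    moreover have "x \<in> J" "x + h \<in> J" "x + h \<noteq> x"
      using that(3) \<open>h \<noteq> 0\<close> by (auto simp: J'_def)
    ultimately show ?thesis
      by (metis eq_iff_diff_eq_0 inj_onD)
  qed
  have "f (x + h) - f x = D 0 (x + h) - D 0 x" if "x \<in> J'" for x
    using that D(1) by (simp add: J'_def)
  then have "kconvex_on k J' (\<lambda>x. f (x + h) - f x)"
    unfolding kconvex_on_def using der nz
    by (intro exI[of _ "\<lambda>j x. D j (x + h) - D j x"]) simp
  then show ?thesis
    unfolding J'_def .
qed

section \<open>Growth of difference sets by induction on the order of convexity\<close>

lemma abs_diffs_le:
  fixes X :: "real set"
  assumes "\<And>x. x \<in> X \<Longrightarrow> \<bar>x\<bar> \<le> g" and "v \<in> diffs m X"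
  shows "\<bar>v\<bar> \<le> 2 * real m * g"
  using assms(2)
proof (induction m arbitrary: v)
  case (Suc m)
  then obtain p a b where v: "v = p + a - b" "p \<in> diffs m X" "a \<in> X" "b \<in> X"
    by auto
  have "\<bar>p\<bar> \<le> 2 * real m * g" "\<bar>a\<bar> \<le> g" "\<bar>b\<bar> \<le> g"
    using Suc.IH v assms(1) by auto
  moreover have "2 * real (Suc m) * g = 2 * real m * g + g + g"
    by (simp add: algebra_simps)
  ultimately show ?case
    using v(1) by linarith
qed simp

text \<open>Pigeonhole over cells of length \<open>g\<close>: the floor of \<open>v / g\<close>
  takes only the \<open>2 * n + 1\<close> integer values from \<open>- n\<close> to
  \<open>n\<close>.\<close>

lemma card_bucket:
  fixes X :: "real set"
  assumes "finite X" "g > 0" and bound: "\<And>v. v \<in> X \<Longrightarrow> \<bar>v\<bar> \<le> real n * g"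
  obtains V where "V \<subseteq> X" "\<And>v w. v \<in> V \<Longrightarrow> w \<in> V \<Longrightarrow> \<bar>v - w\<bar> < g"
    "card X \<le> (2 * n + 1) * card V"
proof -
  define b where "b v = \<lfloor>v / g\<rfloor>" for v
  have "b v \<in> {- int n..int n}" if "v \<in> X" for v
  proof -
    have "v / g \<le> real n" "- real n \<le> v / g"
      using bound[OF that] \<open>g > 0\<close> by (auto simp: field_simps abs_le_iff)
    then show ?thesis
      by (auto simp: b_def le_floor_iff floor_le_iff)
  qed
  then obtain y where y: "card X \<le> card (b -` {y} \<inter> X) * card {- int n..int n}"
    using pigeonhole_card[of b X "{- int n..int n}"] assms(1) by auto
  have "\<bar>v - w\<bar> < g" if "b v = y" "b w = y" for v w
  proof -
    have "of_int y \<le> v / g" "v / g < of_int y + 1" "of_int y \<le> w / g" "w / g < of_int y + 1"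
      using that floor_correct[of "v / g"] floor_correct[of "w / g"] by (auto simp: b_def)
    then have "\<bar>v / g - w / g\<bar> < 1" by linarith
    then have "\<bar>(v - w) / g\<bar> < 1" by (simp add: diff_divide_distrib)
    then show ?thesis using \<open>g > 0\<close> by (simp add: abs_divide divide_simps)
  qed
  moreover have "card X \<le> (2 * n + 1) * card (b -` {y} \<inter> X)"
  proof -
    have "card {- int n..int n} = 2 * n + 1" by simp
    then show ?thesis using y by (metis mult.commute)
  qed
  ultimately show ?thesis
    using that[of "b -` {y} \<inter> X"] by auto
qed

text \<open>Let \<open>g\<close> be the largest \<open>|f (x + h) - f x|\<close> over \<open>U1\<close>. The points of \<open>f ` U2\<close> are \<open>g\<close>-separated, so they
  translate a part of the iterated difference set lying in an interval shorter than \<open>g\<close> to disjoint copies.\<close>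

lemma card_diffs_squeeze:
  fixes f :: "real \<Rightarrow> real"
  assumes J: "is_interval J" and inj: "inj_on f J" and cont: "continuous_on J f"
    and I: "finite I" "I \<subseteq> J" and h: "h > 0"
    and U: "U1 \<subseteq> I" "U2 \<subseteq> I" "U1 \<noteq> {}" "\<And>u. u \<in> U1 \<union> U2 \<Longrightarrow> u + h \<in> I"
    and sep: "\<And>u x. u \<in> U2 \<Longrightarrow> x \<in> I \<Longrightarrow> u < x \<Longrightarrow> u + h \<le> x"
    and split: "\<And>x y. x \<in> U1 \<Longrightarrow> y \<in> U2 \<Longrightarrow> \<bar>f (x + h) - f x\<bar> \<le> \<bar>f (y + h) - f y\<bar>"
  shows "card U2 * card (diffs m ((\<lambda>x. f (x + h) - f x) ` U1))
         \<le> (4 * m + 1) * card (diffs (2 * m + 1) (f ` I))"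
proof (cases "U2 = {}")
  case False
  define G where "G = (\<lambda>x. f (x + h) - f x) ` U1"
  define g where "g = Max (abs ` G)"
  have fin: "finite U1" "finite U2" using U(1,2) I(1) finite_subset by auto
  have G: "finite G" "G \<noteq> {}" using fin U(3) by (auto simp: G_def)
  have gG: "\<bar>x\<bar> \<le> g" if "x \<in> G" for x
    using that G by (auto simp: g_def)
  obtain x0 where x0: "x0 \<in> U1" "g = \<bar>f (x0 + h) - f x0\<bar>"
  proof -
    have "g \<in> abs ` G" unfolding g_def using G by (intro Max_in) auto
    then show ?thesis using that by (auto simp: G_def)
  qed
  have "x0 \<in> J" "x0 + h \<in> J" using x0(1) U I(2) by auto
  then have "f (x0 + h) \<noteq> f x0"
    using inj_onD[OF inj, of "x0 + h" x0] h by auto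
  then have "g > 0" using x0(2) by simp
  \<comment> \<open>\<open>diffs m G\<close> lies between \<open>- 2 * m * g\<close> and
    \<open>2 * m * g\<close>, so one cell of length \<open>g\<close> holds a share of at least
    \<open>1 / (4 * m + 1)\<close>.\<close>
  have bd: "\<bar>v\<bar> \<le> real (2 * m) * g" if "v \<in> diffs m G" for v
    using abs_diffs_le[OF gG that] by simp
  obtain V where V: "V \<subseteq> diffs m G" "\<And>v w. v \<in> V \<Longrightarrow> w \<in> V \<Longrightarrow> \<bar>v - w\<bar> < g"
    "card (diffs m G) \<le> (2 * (2 * m) + 1) * card V"
    using card_bucket[OF finite_diffs[OF G(1)] \<open>g > 0\<close> bd] by blast
  \<comment> \<open>\<open>f\<close> is monotone between \<open>u\<close> and \<open>v\<close>, and
    \<open>u + h\<close> lies between them, so the distance is at least the increment across the gap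
    after \<open>u\<close>.\<close>
  have gap: "g \<le> \<bar>f u - f v\<bar>" if uv: "u \<in> U2" "v \<in> U2" "u < v" for u v
  proof -
    have J': "u \<in> J" "v \<in> J" "u + h \<in> J" using uv U I(2) by auto
    have le: "u + h \<le> v" using sep uv U(2) by blast
    have "{u..v} \<subseteq> J"
      using mem_is_interval_1_I[OF J J'(1,2)] by auto
    then have *: "continuous_on {u..v} f" "inj_on f {u..v}"
      using cont inj by (auto intro: continuous_on_subset inj_on_subset)
    have "\<bar>f (u + h) - f u\<bar> \<le> \<bar>f u - f v\<bar>"
    proof (cases "u + h = v")
      case False
      then show ?thesis
        using continuous_inj_imp_mono[OF _ _ *, of "u + h"] le h by auto
    qed auto
    then show ?thesis
      using split[OF x0(1) uv(1)] x0(2) by linarith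
  qed
  \<comment> \<open>A value of \<open>f\<close> alone is not a difference. Subtracting the fixed
    value \<open>f w\<close> brings \<open>x + v\<close> into a translate of the balanced set; this
    is the extra 1 in \<open>2 * m + 1\<close>.\<close>
  obtain w where w: "w \<in> U2" using False by blast
  have "card (f ` U2) * card V \<le> card ((\<lambda>t. t + f w) ` diffs (2 * m + 1) (f ` I))"
  proof (rule card_mult_le_if_separated[where g = g])
    show "finite ((\<lambda>t. t + f w) ` diffs (2 * m + 1) (f ` I))"
      using I(1) by (intro finite_imageI finite_diffs)
    show "g \<le> \<bar>x - y\<bar>" if xy: "x \<in> f ` U2" "y \<in> f ` U2" "x \<noteq> y" for x y
    proof -
      obtain u v where "x = f u" "y = f v" "u \<in> U2" "v \<in> U2" using xy by auto
      then show ?thesis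
        using gap[of u v] gap[of v u] xy(3) by (cases u v rule: linorder_cases) auto
    qed
    show "x + v \<in> (\<lambda>t. t + f w) ` diffs (2 * m + 1) (f ` I)" if "x \<in> f ` U2" "v \<in> V" for x v
    proof -
      have "v \<in> diffs (2 * m) (f ` I)"
        using that(2) V(1) diffs_forward_difference[of U1 "\<lambda>x. f (x + h)" "f ` I" f m] U
        by (auto simp: G_def)
      moreover have "x \<in> f ` I" "f w \<in> f ` I" using that(1) w U(2) by auto
      ultimately have "v + x - f w \<in> diffs (2 * m + 1) (f ` I)"
        by auto
      moreover have "x + v = (v + x - f w) + f w" by simp
      ultimately show ?thesis by (rule rev_image_eqI)
    qed
  qed (use V in auto)
  also have "\<dots> \<le> card (diffs (2 * m + 1) (f ` I))"
    using I(1) by (intro card_image_le finite_diffs) auto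
  finally have "card (f ` U2) * card V \<le> card (diffs (2 * m + 1) (f ` I))" .
  moreover have "card (f ` U2) = card U2"
    using inj U(2) I(2) by (intro card_image) (meson inj_on_subset subset_trans)
  ultimately have *: "card U2 * card V \<le> card (diffs (2 * m + 1) (f ` I))" by simp
  have "card U2 * card (diffs m G) \<le> card U2 * ((2 * (2 * m) + 1) * card V)"
    using V(3) by (rule mult_left_mono) simp
  also have "\<dots> = (4 * m + 1) * (card U2 * card V)" by (simp add: algebra_simps)
  also have "\<dots> \<le> (4 * m + 1) * card (diffs (2 * m + 1) (f ` I))"
    using * by (rule mult_left_mono) simp
  finally show ?thesis unfolding G_def .
qed simp


text \<open>The induction hypothesis is applied to the increments across the popular gap on
  \<open>V\<close>, the half of \<open>U\<close> where they are smaller; \<open>U - V\<close>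
  supplies the separated translates.\<close>

lemma card_diffs_kconvex_step:
  fixes f :: "real \<Rightarrow> real" and I :: "real set"
  assumes IH: "\<And>J f I. is_interval J \<Longrightarrow> kconvex_on k J f \<Longrightarrow> finite I \<Longrightarrow> I \<noteq> {} \<Longrightarrow> I \<subseteq> J \<Longrightarrow>
      real (card I) ^ k \<le> C * (real (card (two_minus I)) / real (card I)) ^ p * real (card (diffs m (f ` I)))"
    and "C \<ge> 1"
    and J: "is_interval J" and f: "kconvex_on (Suc k) J f" and I: "finite I" "I \<noteq> {}" "I \<subseteq> J"
  shows "real (card I) ^ Suc k \<le> (48 ^ Suc k * 48 ^ p * C * real (4 * m + 1))
    * (real (card (two_minus I)) / real (card I)) ^ (Suc k + 2 * p) * real (card (diffs (2 * m + 1) (f ` I)))"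
proof -
  define N where "N = real (card I)"
  define M where "M = real (card (two_minus I))"
  define K where "K = M / N"
  define D where "D = real (card (diffs (2 * m + 1) (f ` I)))"
  define C' where "C' = 48 ^ Suc k * 48 ^ p * C * real (4 * m + 1)"
  have N: "N \<ge> 1" using I by (simp add: N_def Suc_leI card_gt_0_iff)
  have "M \<ge> N" using card_two_minus_ge[OF I(1)] by (simp add: M_def N_def)
  then have K: "K \<ge> 1" using N by (simp add: K_def)
  have D: "D \<ge> 1"
    using card_diffs_pos[of "f ` I" "2 * m + 1"] I unfolding D_def by fastforce
  have main: "N ^ Suc k \<le> C' * K ^ (Suc k + 2 * p) * D"
  proof (cases "N \<le> 16 * K")
    \<comment> \<open>Here powers of \<open>K\<close> alone suffice. In the other case
      \<open>N \<le> 16 * K * n\<close> forces \<open>n \<ge> 2\<close>, so neither half of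
      \<open>U\<close> is empty.\<close>
    case True
    have "N ^ Suc k \<le> (48 * K) ^ Suc k"
      using True N K by (intro power_mono) auto
    also have "\<dots> = 48 ^ Suc k * K ^ Suc k" by (rule power_mult_distrib)
    also have "\<dots> \<le> C' * K ^ (Suc k + 2 * p)"
    proof (rule mult_mono)
      have "1 * 1 * 1 \<le> 48 ^ p * C * real (4 * m + 1)"
        using \<open>C \<ge> 1\<close> by (intro mult_mono) auto
      then have "48 ^ Suc k * 1 \<le> 48 ^ Suc k * (48 ^ p * C * real (4 * m + 1))"
        by (intro mult_left_mono) auto
      then show "48 ^ Suc k \<le> C'" by (simp add: C'_def mult_ac)
      show "K ^ Suc k \<le> K ^ (Suc k + 2 * p)" using K by (intro power_increasing) auto
    qed (use K \<open>C \<ge> 1\<close> in \<open>auto simp: C'_def\<close>)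
    also have "\<dots> \<le> C' * K ^ (Suc k + 2 * p) * D"
      using D K \<open>C \<ge> 1\<close> mult_left_mono[of 1 D "C' * K ^ (Suc k + 2 * p)"] by (simp add: C'_def)
    finally show ?thesis .
  next
    case False
    have "card I \<ge> 2"
    proof (rule ccontr)
      assume "\<not> card I \<ge> 2"
      then have "N \<le> 1" by (simp add: N_def)
      then show False using False K by linarith
    qed
    then obtain h U where h: "h > 0" and U: "U \<subseteq> I" "\<And>u. u \<in> U \<Longrightarrow> u + h \<in> I"
      "\<And>u x. u \<in> U \<Longrightarrow> x \<in> I \<Longrightarrow> u < x \<Longrightarrow> u + h \<le> x"
      and cU: "card I ^ 2 \<le> 16 * card (two_minus I) * card U"
      using popular_gap[OF I(1)] by blast
    define n where "n = card U"
    have "real (card I ^ 2) \<le> real (16 * card (two_minus I) * card U)"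
      using cU by (rule of_nat_mono)
    then have "N ^ 2 \<le> 16 * M * real n"
      by (simp add: N_def M_def n_def)
    then have Nn: "N \<le> 16 * K * real n"
      using N by (simp add: K_def field_simps power2_eq_square)
    have "n \<ge> 2"
    proof (rule ccontr)
      assume "\<not> n \<ge> 2"
      then have "16 * K * real n \<le> 16 * K * 1"
        using K by (intro mult_left_mono) auto
      then show False using False Nn by linarith
    qed
    have finU: "finite U" using U(1) I(1) finite_subset by blast
    obtain V where V: "V \<subseteq> U" "card V = n div 2"
      "\<forall>x\<in>V. \<forall>y\<in>U - V. \<bar>f (x + h) - f x\<bar> \<le> \<bar>f (y + h) - f y\<bar>"
      using split_by_weight[OF finU, of "n div 2" "\<lambda>x. \<bar>f (x + h) - f x\<bar>"] by (auto simp: n_def)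
    define n1 where "n1 = real (card V)"
    define n2 where "n2 = real (card (U - V))"
    have finV: "finite V" using V(1) finU finite_subset by blast
    have nn2: "card (U - V) = n - n div 2"
      using card_Diff_subset[OF finV V(1)] V(2) by (simp add: n_def)
    have n1: "n1 \<ge> 1" using V(2) \<open>n \<ge> 2\<close> by (simp add: n1_def)
    \<comment> \<open>The worst case is \<open>n = 3\<close>; this is the origin of
      \<open>48 = 3 * 16\<close>.\<close>
    have "n \<le> 3 * (n div 2)" using \<open>n \<ge> 2\<close> by presburger
    then have nn1: "real n \<le> 3 * n1"
      unfolding n1_def V(2) by linarith
    have "n \<le> 2 * (n - n div 2)" by presburger
    then have nn2: "real n \<le> 2 * n2"
      unfolding n2_def nn2 by linarith
    have "V \<noteq> {}" using n1 by (auto simp: n1_def)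
    define G where "G = (\<lambda>x. f (x + h) - f x) ` V"
    define d where "d = real (card (diffs m G))"
    define K1 where "K1 = real (card (two_minus V)) / n1"
    have "n1 ^ k \<le> C * K1 ^ p * d"
      unfolding n1_def K1_def d_def G_def
    proof (rule IH)
      show "is_interval {x\<in>J. x + h \<in> J}" by (rule is_interval_forward_shift[OF J])
      show "kconvex_on k {x\<in>J. x + h \<in> J} (\<lambda>x. f (x + h) - f x)"
        using kconvex_on_forward_difference[OF J f] h by simp
      show "V \<subseteq> {x\<in>J. x + h \<in> J}" using V(1) U I(3) by blast
    qed (use finV \<open>V \<noteq> {}\<close> in auto)
    \<comment> \<open>\<open>2V - V\<close> has at most \<open>K * N\<close> elements and
      \<open>V\<close> at least \<open>N / (48 * K)\<close>. The square doubles the exponent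
      \<open>p\<close>; the remaining \<open>Suc k\<close> comes from \<open>16 * K\<close> raised
      to that power.\<close>
    moreover have "K1 \<le> 48 * K\<^sup>2"
    proof -
      have "card (two_minus V) \<le> card (two_minus I)"
        using V(1) U(1) by (intro card_mono finite_two_minus[OF I(1)] two_minus_mono) auto
      then have "K1 * n1 \<le> M" using n1 by (simp add: K1_def M_def)
      also have "M = K * N" using N by (simp add: K_def)
      also have "\<dots> \<le> K * (16 * K * real n)" using Nn K by (intro mult_left_mono) auto
      also have "\<dots> \<le> K * (16 * K * (3 * n1))" using nn1 K by (intro mult_left_mono) auto
      finally have "K1 * n1 \<le> (48 * K\<^sup>2) * n1" by (simp add: power2_eq_square)
      then show ?thesis using n1 by simp
    qed
    moreover have K1: "K1 \<ge> 0" using n1 by (simp add: K1_def)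
    ultimately have n1k: "n1 ^ k \<le> C * (48 * K\<^sup>2) ^ p * d"
      using \<open>C \<ge> 1\<close> by (smt (verit) mult_left_mono mult_right_mono power_mono d_def of_nat_0_le_iff)
    have "card (U - V) * card (diffs m ((\<lambda>x. f (x + h) - f x) ` V))
         \<le> (4 * m + 1) * card (diffs (2 * m + 1) (f ` I))"
    proof (rule card_diffs_squeeze[OF J _ _ I(1,3) h])
      show "inj_on f J" using kconvex_on_inj[OF J f] by simp
      show "continuous_on J f" using kconvex_on_continuous[OF f] by simp
    qed (use U V \<open>V \<noteq> {}\<close> in auto)
    then have n2d: "n2 * d \<le> real (4 * m + 1) * D"
      unfolding n2_def d_def D_def G_def of_nat_mult[symmetric] by (rule of_nat_mono)
    have "N ^ Suc k \<le> (16 * K * real n) ^ Suc k"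
      using Nn N by (intro power_mono) auto
    also have "\<dots> = (16 * K * real n) ^ k * (16 * K * real n)" by simp
    also have "\<dots> \<le> (16 * K * (3 * n1)) ^ k * (16 * K * (2 * n2))"
      using nn1 nn2 K by (intro mult_mono power_mono mult_left_mono) auto
    also have "\<dots> = 48 ^ k * K ^ k * (32 * K * n2) * n1 ^ k"
      by (simp add: power_mult_distrib algebra_simps)
    also have "\<dots> \<le> 48 ^ k * K ^ k * (32 * K * n2) * (C * (48 * K\<^sup>2) ^ p * d)"
      using n1k K by (intro mult_left_mono) (auto simp: n2_def)
    also have "\<dots> = 48 ^ k * 32 * 48 ^ p * C * K ^ (Suc k + 2 * p) * (n2 * d)"
    proof -
      have "(48 * K\<^sup>2) ^ p = 48 ^ p * K ^ (2 * p)" "K ^ (Suc k + 2 * p) = K ^ k * K * K ^ (2 * p)"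
        by (simp_all add: power_mult_distrib power_add power_mult)
      then show ?thesis by (simp only: mult_ac)
    qed
    also have "\<dots> \<le> 48 ^ k * 48 * 48 ^ p * C * K ^ (Suc k + 2 * p) * (n2 * d)"
      using K \<open>C \<ge> 1\<close> by (intro mult_right_mono) (auto simp: n2_def d_def)
    also have "\<dots> \<le> 48 ^ k * 48 * 48 ^ p * C * K ^ (Suc k + 2 * p) * (real (4 * m + 1) * D)"
      using n2d K \<open>C \<ge> 1\<close> by (intro mult_left_mono) auto
    finally show ?thesis by (simp add: C'_def mult_ac)
  qed
  then show ?thesis
    unfolding N_def K_def M_def D_def C'_def .
qed

text \<open>For \<open>k = 1\<close>, injectivity of \<open>f\<close> gives
  \<open>|A - A| \<ge> |I|\<close>. Each step replaces \<open>m\<close> by \<open>2 * m + 1\<close>,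
  so the construction yields \<open>m = 2 ^ k - 1\<close>. What counts later is that
  \<open>m\<close>, \<open>p\<close> and \<open>C\<close> are fixed by \<open>k\<close>.\<close>

theorem card_diffs_kconvex:
  assumes "k \<ge> 1"
  obtains m p :: nat and C :: real where "C \<ge> 1"
    "\<And>J f I. is_interval J \<Longrightarrow> kconvex_on k J f \<Longrightarrow> finite I \<Longrightarrow> I \<noteq> {} \<Longrightarrow> I \<subseteq> J \<Longrightarrow>
      real (card I) ^ k \<le> C * (real (card (two_minus I)) / real (card I)) ^ p * real (card (diffs m (f ` I)))"
proof -
  have "\<exists>m p C. C \<ge> 1 \<and> (\<forall>J f I. is_interval J \<longrightarrow> kconvex_on k J f \<longrightarrow> finite I \<longrightarrow> I \<noteq> {} \<longrightarrow> I \<subseteq> J \<longrightarrow>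
      real (card I) ^ k \<le> C * (real (card (two_minus I)) / real (card I)) ^ p * real (card (diffs m (f ` I))))"
    using assms
  proof (induction k rule: nat_induct_at_least)
    case base
    have "real (card I) \<le> real (card (diffs 1 (f ` I)))"
      if J: "is_interval J" and f: "kconvex_on 1 J f" and I: "finite I" "I \<noteq> {}" "I \<subseteq> J" for J f I
    proof -
      obtain a where a: "a \<in> I" using I by blast
      have "(\<lambda>x. x - f a) ` f ` I \<subseteq> diffs 1 (f ` I)"
        using a by force
      then have "card ((\<lambda>x. x - f a) ` f ` I) \<le> card (diffs 1 (f ` I))"
        using I(1) by (intro card_mono finite_diffs) auto
      moreover have "card ((\<lambda>x. x - f a) ` f ` I) = card (f ` I)"
        by (intro card_image) (auto simp: inj_on_def)
      moreover have "card (f ` I) = card I"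
        using kconvex_on_inj[OF J f] I(3) by (intro card_image) (auto intro: inj_on_subset)
      ultimately show ?thesis by simp
    qed
    then show ?case
      by (intro exI[of _ 1] exI[of _ 0] exI[of _ "1::real"]) auto
  next
    case (Suc k)
    then obtain m p and C :: real where "C \<ge> 1" and
      IH: "\<And>J f I. is_interval J \<Longrightarrow> kconvex_on k J f \<Longrightarrow> finite I \<Longrightarrow> I \<noteq> {} \<Longrightarrow> I \<subseteq> J \<Longrightarrow>
      real (card I) ^ k \<le> C * (real (card (two_minus I)) / real (card I)) ^ p * real (card (diffs m (f ` I)))"
      by blast
    have "1 * 1 * 1 * 1 \<le> 48 ^ Suc k * 48 ^ p * C * real (4 * m + 1)"
      using \<open>C \<ge> 1\<close> by (intro mult_mono one_le_power) auto
    then show ?case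
      by (intro exI[of _ "2 * m + 1"] exI[of _ "Suc k + 2 * p"]
          exI[of _ "48 ^ Suc k * 48 ^ p * C * real (4 * m + 1)"] conjI allI impI
          card_diffs_kconvex_step[OF IH \<open>C \<ge> 1\<close>]) (assumption | simp)+
  qed
  then show ?thesis using that by blast
qed

section \<open>Balog--Szemeredi--Gowers for probability weights\<close>

lemma mass_exists_ge:
  fixes \<mu> :: "'a \<Rightarrow> real"
  assumes "finite C" "\<And>c. c \<in> C \<Longrightarrow> \<mu> c \<ge> 0" "a < (\<Sum>c\<in>C. \<mu> c * x c)" "sum \<mu> C * t \<le> a"
  obtains c where "c \<in> C" "x c > t"
proof -
  have "\<exists>c\<in>C. x c > t"
  proof (rule ccontr)
    assume "\<not> (\<exists>c\<in>C. x c > t)"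
    then have "(\<Sum>c\<in>C. \<mu> c * x c) \<le> (\<Sum>c\<in>C. \<mu> c * t)"
      using assms(2) by (intro sum_mono mult_left_mono) (auto simp: not_less)
    then show False using assms(3,4) by (simp add: sum_distrib_right)
  qed
  then show ?thesis using that by blast
qed

lemma sum_Collect_eq_of_bool:
  fixes \<mu> :: "'a \<Rightarrow> real"
  assumes "finite C"
  shows "sum \<mu> {c\<in>C. p c} = (\<Sum>c\<in>C. \<mu> c * of_bool (p c))"
  using assms by (simp add: sum.inter_filter if_distrib of_bool_def cong: if_cong)

text \<open>Dependent random choice: \<open>B\<close> is the neighbourhood of a random vertex \<open>c\<close>. On average only few
  pairs in \<open>B\<close> have few common neighbours.\<close>

lemma dependent_random_choice:
  fixes \<mu> :: "'a \<Rightarrow> real" and R :: "'a \<Rightarrow> 'a \<Rightarrow> bool"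
  assumes C: "finite C" and nonneg: "\<And>c. c \<in> C \<Longrightarrow> \<mu> c \<ge> 0" and mass: "sum \<mu> C \<le> 1"
    and \<delta>: "\<delta> > 0" "\<delta> \<le> (\<Sum>b\<in>C. \<Sum>c\<in>C. \<mu> b * \<mu> c * of_bool (R b c))"
  defines "good \<equiv> \<lambda>b b'. \<delta>\<^sup>2 / 16 \<le> sum \<mu> {c\<in>C. R b c \<and> R b' c}"
  obtains B D where "B \<subseteq> C" "D \<subseteq> B" "\<delta> / 2 \<le> sum \<mu> B" "sum \<mu> B / 2 \<le> sum \<mu> D"
    "\<And>b b'. b \<in> D \<Longrightarrow> b' \<in> D \<Longrightarrow> sum \<mu> B / 2 \<le> sum \<mu> {c\<in>B. good b c \<and> good b' c}"
proof -
  define N where "N c = {b\<in>C. R b c}" for c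
  define a where "a c = sum \<mu> (N c)" for c
  define bad where "bad c = (\<Sum>b\<in>N c. \<Sum>b'\<in>N c. \<mu> b * \<mu> b' * of_bool (\<not> good b b'))" for c
  have a_eq: "a c = (\<Sum>b\<in>C. \<mu> b * of_bool (R b c))" for c
    unfolding a_def N_def using C by (rule sum_Collect_eq_of_bool)
  have "(\<Sum>c\<in>C. \<mu> c * a c) = (\<Sum>c\<in>C. \<Sum>b\<in>C. \<mu> b * \<mu> c * of_bool (R b c))"
    by (simp add: a_eq sum_distrib_left mult_ac)
  also have "\<dots> = (\<Sum>b\<in>C. \<Sum>c\<in>C. \<mu> b * \<mu> c * of_bool (R b c))"
    by (rule sum.swap)
  finally have a1: "\<delta> \<le> (\<Sum>c\<in>C. \<mu> c * a c)" using \<delta>(2) by simp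
  \<comment> \<open>Expanding a variance-like square plays the part of Cauchy-Schwarz and tolerates
    a total mass below 1.\<close>
  have "0 \<le> (\<Sum>c\<in>C. \<mu> c * (a c - \<delta>)\<^sup>2)"
    using nonneg by (intro sum_nonneg) auto
  also have "\<dots> = (\<Sum>c\<in>C. \<mu> c * (a c)\<^sup>2) - 2 * \<delta> * (\<Sum>c\<in>C. \<mu> c * a c) + \<delta>\<^sup>2 * sum \<mu> C"
    by (simp add: power2_diff algebra_simps sum.distrib sum_subtractf sum_distrib_left sum_distrib_right)
  finally have "2 * \<delta> * (\<Sum>c\<in>C. \<mu> c * a c) - \<delta>\<^sup>2 * sum \<mu> C \<le> (\<Sum>c\<in>C. \<mu> c * (a c)\<^sup>2)" by simp
  moreover have "2 * \<delta> * \<delta> \<le> 2 * \<delta> * (\<Sum>c\<in>C. \<mu> c * a c)"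
    using a1 \<delta>(1) by (intro mult_left_mono) auto
  moreover have "\<delta>\<^sup>2 * sum \<mu> C \<le> \<delta>\<^sup>2 * 1"
    using mass by (intro mult_left_mono) auto
  ultimately have a2: "\<delta>\<^sup>2 \<le> (\<Sum>c\<in>C. \<mu> c * (a c)\<^sup>2)"
    by (simp add: power2_eq_square)
  have bad_eq: "bad c = (\<Sum>b\<in>C. \<Sum>b'\<in>C. \<mu> b * \<mu> b' * of_bool (\<not> good b b') * of_bool (R b c \<and> R b' c))" for c
    unfolding bad_def N_def
    by (simp only: sum_Collect_eq_of_bool[OF C] sum_distrib_right) (simp only: of_bool_conj mult_ac)
  have "(\<Sum>c\<in>C. \<mu> c * bad c) = (\<Sum>c\<in>C. \<Sum>b\<in>C. \<Sum>b'\<in>C. \<mu> b * \<mu> b' * of_bool (\<not> good b b') * (\<mu> c * of_bool (R b c \<and> R b' c)))"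
    by (simp add: bad_eq sum_distrib_left mult_ac)
  also have "\<dots> = (\<Sum>b\<in>C. \<Sum>b'\<in>C. \<Sum>c\<in>C. \<mu> b * \<mu> b' * of_bool (\<not> good b b') * (\<mu> c * of_bool (R b c \<and> R b' c)))"
    by (subst sum.swap, rule sum.cong[OF refl], rule sum.swap)
  also have "\<dots> = (\<Sum>b\<in>C. \<Sum>b'\<in>C. \<mu> b * \<mu> b' * of_bool (\<not> good b b') * sum \<mu> {c\<in>C. R b c \<and> R b' c})"
    by (simp only: sum_Collect_eq_of_bool[OF C] sum_distrib_left)
  also have "\<dots> \<le> (\<Sum>b\<in>C. \<Sum>b'\<in>C. \<mu> b * \<mu> b' * (\<delta>\<^sup>2 / 16))"
  proof (intro sum_mono)
    fix b b'
    assume "b \<in> C" "b' \<in> C"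
    then have *: "0 \<le> \<mu> b * \<mu> b'" using nonneg by simp
    show "\<mu> b * \<mu> b' * of_bool (\<not> good b b') * sum \<mu> {c\<in>C. R b c \<and> R b' c} \<le> \<mu> b * \<mu> b' * (\<delta>\<^sup>2 / 16)"
    proof (cases "good b b'")
      case False
      then have "sum \<mu> {c\<in>C. R b c \<and> R b' c} \<le> \<delta>\<^sup>2 / 16" by (simp add: good_def)
      from mult_left_mono[OF this *] show ?thesis using False by simp
    qed (use * in simp)
  qed
  also have "\<dots> = (sum \<mu> C * sum \<mu> C) * (\<delta>\<^sup>2 / 16)"
    by (simp only: sum_product) (simp only: sum_distrib_right)
  also have "\<dots> \<le> (1 * 1) * (\<delta>\<^sup>2 / 16)"
    using mass nonneg by (intro mult_right_mono mult_mono) (auto intro: sum_nonneg)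
  finally have bad1: "(\<Sum>c\<in>C. \<mu> c * bad c) \<le> \<delta>\<^sup>2 / 16" by simp
  \<comment> \<open>One functional secures both requirements: where it exceeds
    \<open>\<delta>\<^sup>2 / 4\<close>, the neighbourhood has mass at least
    \<open>\<delta> / 2\<close> and its bad pairs have weight at most
    \<open>(a c)\<^sup>2 / 8\<close>.\<close>
  have "(\<Sum>c\<in>C. \<mu> c * ((a c)\<^sup>2 - 8 * bad c)) = (\<Sum>c\<in>C. \<mu> c * (a c)\<^sup>2) - 8 * (\<Sum>c\<in>C. \<mu> c * bad c)"
    by (simp add: algebra_simps sum_subtractf sum_distrib_left)
  then have "\<delta>\<^sup>2 / 2 \<le> (\<Sum>c\<in>C. \<mu> c * ((a c)\<^sup>2 - 8 * bad c))"
    using a2 bad1 by simp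
  then have "\<delta>\<^sup>2 / 4 < (\<Sum>c\<in>C. \<mu> c * ((a c)\<^sup>2 - 8 * bad c))"
    using zero_less_power[OF \<delta>(1), of 2] by linarith
  moreover have "sum \<mu> C * (\<delta>\<^sup>2 / 4) \<le> \<delta>\<^sup>2 / 4"
    using mult_right_mono[OF mass, of "\<delta>\<^sup>2 / 4"] by simp
  ultimately obtain c where c: "c \<in> C" "(a c)\<^sup>2 - 8 * bad c > \<delta>\<^sup>2 / 4"
    using mass_exists_ge[where \<mu> = \<mu> and x = "\<lambda>c. (a c)\<^sup>2 - 8 * bad c", OF C nonneg] by blast
  define B where "B = N c"
  have BC: "B \<subseteq> C" by (auto simp: B_def N_def)
  have finB: "finite B" using BC C finite_subset by blast
  have a0: "0 \<le> a c" unfolding a_def N_def using nonneg by (intro sum_nonneg) auto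
  have sB: "sum \<mu> B = a c" by (simp add: a_def B_def)
  have "bad c \<ge> 0"
    unfolding bad_def N_def using nonneg by (intro sum_nonneg mult_nonneg_nonneg) auto
  then have "(\<delta> / 2)\<^sup>2 \<le> (a c)\<^sup>2" using c(2) by (simp add: power_divide)
  then have aB: "\<delta> / 2 \<le> a c"
    using a0 \<delta>(1) by (simp add: power2_le_iff_abs_le)
  then have apos: "a c > 0" using \<delta>(1) by linarith
  \<comment> \<open>By Markov's inequality \<open>D\<close> keeps half of the mass of
    \<open>B\<close>. Two vertices of \<open>D\<close> together exclude partners of mass at most
    \<open>a c / 2\<close>, which leaves the other half of \<open>B\<close> as common good
    partners.\<close>
  define D where "D = {b\<in>B. sum \<mu> {b'\<in>B. \<not> good b b'} \<le> a c / 4}"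
  have "sum \<mu> (B - D) * (a c / 4) = (\<Sum>b\<in>B - D. \<mu> b * (a c / 4))"
    by (rule sum_distrib_right)
  also have "\<dots> \<le> (\<Sum>b\<in>B - D. \<mu> b * sum \<mu> {b'\<in>B. \<not> good b b'})"
    using nonneg BC by (intro sum_mono mult_left_mono) (auto simp: D_def)
  also have "\<dots> \<le> (\<Sum>b\<in>B. \<mu> b * sum \<mu> {b'\<in>B. \<not> good b b'})"
    using finB nonneg BC by (intro sum_mono2) (auto intro!: mult_nonneg_nonneg sum_nonneg)
  also have "\<dots> = bad c"
    unfolding bad_def B_def[symmetric]
    by (simp only: sum_Collect_eq_of_bool[OF finB] sum_distrib_left mult.assoc)
  also have "\<dots> \<le> (a c)\<^sup>2 / 8"
    using c(2) zero_le_power2[of \<delta>] by linarith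
  finally have "sum \<mu> (B - D) * a c \<le> (a c / 2) * a c" by (simp add: power2_eq_square mult_ac)
  then have "sum \<mu> (B - D) \<le> a c / 2" using apos by simp
  moreover have DB: "D \<subseteq> B" by (auto simp: D_def)
  moreover have "sum \<mu> (B - D) = sum \<mu> B - sum \<mu> D"
    by (rule sum_diff[OF finB DB])
  ultimately have mD: "sum \<mu> B / 2 \<le> sum \<mu> D" using sB by simp
  have "sum \<mu> B / 2 \<le> sum \<mu> {c\<in>B. good b c \<and> good b' c}" if "b \<in> D" "b' \<in> D" for b b'
  proof -
    have "sum \<mu> B = sum \<mu> {c\<in>B. good b c \<and> good b' c} + sum \<mu> {c\<in>B. \<not> (good b c \<and> good b' c)}"
      using finB by (subst sum.union_disjoint[symmetric]) (auto intro: sum.cong)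
    moreover have "sum \<mu> {c\<in>B. \<not> (good b c \<and> good b' c)}
        \<le> sum \<mu> {c\<in>B. \<not> good b c} + sum \<mu> {c\<in>B. \<not> good b' c}"
    proof -
      have "(\<Sum>c\<in>B. \<mu> c * of_bool (\<not> (good b c \<and> good b' c)))
          \<le> (\<Sum>c\<in>B. \<mu> c * of_bool (\<not> good b c) + \<mu> c * of_bool (\<not> good b' c))"
        using nonneg BC by (intro sum_mono) (auto simp: of_bool_def)
      then show ?thesis
        using finB by (simp only: sum_Collect_eq_of_bool sum.distrib)
    qed
    moreover have "sum \<mu> {c\<in>B. \<not> good b c} \<le> a c / 4" "sum \<mu> {c\<in>B. \<not> good b' c} \<le> a c / 4"
      using that by (auto simp: D_def)
    ultimately show ?thesis using sB by linarith
  qed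
  then show ?thesis
    using that[OF BC DB _ mD] aB sB by simp
qed

section \<open>Popular differences of a probability measure\<close>

lemma card_fibre_bound:
  fixes n :: real
  assumes "finite V" "finite U" "\<And>u. u \<in> U \<Longrightarrow> n \<le> real (card {v\<in>V. g v = u})"
  shows "real (card U) * n \<le> real (card V)"
proof -
  have "real (card U) * n = (\<Sum>u\<in>U. n)" by simp
  also have "\<dots> \<le> real (\<Sum>u\<in>U. card {v\<in>V. g v = u})"
    unfolding of_nat_sum using assms(3) by (rule sum_mono)
  also have "(\<Sum>u\<in>U. card {v\<in>V. g v = u}) \<le> card V"
    using assms by (intro sum_card_disjoint_le) auto
  finally show ?thesis by simp
qed

lemma mass_le_card_mult:
  fixes \<mu> :: "'a \<Rightarrow> real"
  assumes "T > 0" "\<And>x. x \<in> X \<Longrightarrow> \<mu> x \<le> T" "m \<le> sum \<mu> X"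
  shows "m / T \<le> real (card X)"
proof -
  have "m \<le> real (card X) * T"
    using assms(3) sum_bounded_above[of X \<mu> T] assms(2) by fastforce
  then show ?thesis using assms(1) by (simp add: field_simps)
qed

text \<open>For a probability measure \<open>\<mu>\<close> on \<open>Z\<close> this is the law of
  the difference of two independent samples, the convolution of \<open>\<mu>\<close> with its
  reflection.\<close>

definition autocorr :: "('a::ab_group_add \<Rightarrow> real) \<Rightarrow> 'a set \<Rightarrow> 'a \<Rightarrow> real" where
  "autocorr \<mu> Z d = (\<Sum>x\<in>Z. \<Sum>y\<in>Z. \<mu> x * \<mu> y * of_bool (x - y = d))"

definition diffset :: "'a::ab_group_add set \<Rightarrow> 'a set" where
  "diffset D = (\<lambda>(x, y). x - y) ` (D \<times> D)"

lemma finite_diffset: "finite D \<Longrightarrow> finite (diffset D)"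
  by (simp add: diffset_def)

lemma diffsetI: "x \<in> D \<Longrightarrow> y \<in> D \<Longrightarrow> x - y \<in> diffset D"
  by (force simp: diffset_def)

lemma sum_of_bool_eq_le_one:
  assumes "finite Z" "inj_on g Z"
  shows "(\<Sum>y\<in>Z. of_bool (g y = c)) \<le> (1::real)"
proof -
  have "(\<Sum>y\<in>Z. of_bool (g y = c)) = (\<Sum>y\<in>{y\<in>Z. g y = c}. 1 :: real)"
    using sum_Collect_eq_of_bool[OF assms(1), of "\<lambda>_. 1" "\<lambda>y. g y = c"] by simp
  also have "\<dots> = real (card {y\<in>Z. g y = c})" by simp
  also have "card {y\<in>Z. g y = c} \<le> 1"
    using assms by (intro card_le_Suc0_iff_eq[THEN iffD2, folded One_nat_def]) (auto dest: inj_onD)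
  finally show ?thesis by simp
qed

text \<open>Bound \<open>\<mu> x * \<mu> y\<close> by the mean of the squares; for given
  \<open>d\<close> each of \<open>x\<close>, \<open>y\<close> determines the other. The bound is the
  value at \<open>d = 0\<close>, so 0 is the most popular difference.\<close>

lemma autocorr_le:
  assumes Z: "finite Z"
  shows "autocorr \<mu> Z d \<le> (\<Sum>x\<in>Z. (\<mu> x)\<^sup>2)"
proof -
  have "autocorr \<mu> Z d \<le> (\<Sum>x\<in>Z. \<Sum>y\<in>Z. ((\<mu> x)\<^sup>2 / 2 + (\<mu> y)\<^sup>2 / 2) * of_bool (x - y = d))"
    unfolding autocorr_def
  proof (intro sum_mono mult_right_mono)
    fix x y
    show "\<mu> x * \<mu> y \<le> (\<mu> x)\<^sup>2 / 2 + (\<mu> y)\<^sup>2 / 2"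
      using sum_squares_bound[of "\<mu> x" "\<mu> y"] by simp
  qed simp
  also have "\<dots> = (\<Sum>x\<in>Z. \<Sum>y\<in>Z. (\<mu> x)\<^sup>2 / 2 * of_bool (x - y = d))
      + (\<Sum>x\<in>Z. \<Sum>y\<in>Z. (\<mu> y)\<^sup>2 / 2 * of_bool (x - y = d))"
    by (simp only: distrib_right sum.distrib)
  also have "(\<Sum>x\<in>Z. \<Sum>y\<in>Z. (\<mu> y)\<^sup>2 / 2 * of_bool (x - y = d))
      = (\<Sum>y\<in>Z. (\<mu> y)\<^sup>2 / 2 * (\<Sum>x\<in>Z. of_bool (x - y = d)))"
    by (subst sum.swap) (simp only: sum_distrib_left)
  also have "\<dots> \<le> (\<Sum>y\<in>Z. (\<mu> y)\<^sup>2 / 2 * 1)"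
    using Z by (intro sum_mono mult_left_mono sum_of_bool_eq_le_one) (auto simp: inj_on_def)
  also have "(\<Sum>x\<in>Z. \<Sum>y\<in>Z. (\<mu> x)\<^sup>2 / 2 * of_bool (x - y = d))
      = (\<Sum>x\<in>Z. (\<mu> x)\<^sup>2 / 2 * (\<Sum>y\<in>Z. of_bool (x - y = d)))"
    by (simp only: sum_distrib_left)
  also have "\<dots> \<le> (\<Sum>x\<in>Z. (\<mu> x)\<^sup>2 / 2 * 1)"
    using Z by (intro sum_mono mult_left_mono sum_of_bool_eq_le_one) (auto simp: inj_on_def)
  finally show ?thesis
    by (simp add: sum_divide_distrib[symmetric])
qed

lemma sum_autocorr:
  assumes P: "finite P"
  shows "(\<Sum>d\<in>P. autocorr \<mu> Z d) = (\<Sum>x\<in>Z. \<Sum>y\<in>Z. \<mu> x * \<mu> y * of_bool (x - y \<in> P))"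
proof -
  have "(\<Sum>d\<in>P. autocorr \<mu> Z d) = (\<Sum>x\<in>Z. \<Sum>d\<in>P. \<Sum>y\<in>Z. \<mu> x * \<mu> y * of_bool (x - y = d))"
    unfolding autocorr_def by (rule sum.swap)
  also have "\<dots> = (\<Sum>x\<in>Z. \<Sum>y\<in>Z. \<Sum>d\<in>P. \<mu> x * \<mu> y * of_bool (x - y = d))"
    by (intro sum.cong refl sum.swap)
  also have "\<dots> = (\<Sum>x\<in>Z. \<Sum>y\<in>Z. \<mu> x * \<mu> y * of_bool (x - y \<in> P))"
    using P by (simp add: sum_distrib_left[symmetric] of_bool_def)
  finally show ?thesis .
qed

lemma sum_autocorr_le:
  assumes nonneg: "\<And>x. x \<in> Z \<Longrightarrow> \<mu> x \<ge> 0" and P: "finite P"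
  shows "(\<Sum>d\<in>P. autocorr \<mu> Z d) \<le> (sum \<mu> Z)\<^sup>2"
proof -
  have "(\<Sum>d\<in>P. autocorr \<mu> Z d) \<le> (\<Sum>x\<in>Z. \<Sum>y\<in>Z. \<mu> x * \<mu> y)"
    unfolding sum_autocorr[OF P] using nonneg by (intro sum_mono) (auto simp: of_bool_def)
  then show ?thesis
    by (simp add: sum_product power2_eq_square)
qed

lemma card_le_of_popular:
  fixes P X :: "'a::ab_group_add set"
  assumes "finite P" "finite X"
    and "\<And>x. x \<in> X \<Longrightarrow> n \<le> real (card {q\<in>P \<times> P. fst q - snd q = x})"
  shows "real (card X) * n \<le> (real (card P))\<^sup>2"
  using card_fibre_bound[of "P \<times> P" X n "\<lambda>q. fst q - snd q"] assms
  by (simp add: card_cartesian_product power2_eq_square)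

text \<open>Balog--Szemeredi--Gowers for a probability measure \<open>\<mu>\<close>. The popular differences form a dense graph on
  the support. Two vertices with many common neighbours have a difference in the small set \<open>W\<close>, and any
  two vertices of \<open>D\<close> are joined by many paths of two such edges. Discarding the
  points of large mass turns masses into lower bounds for cardinalities.\<close>

lemma small_diffset:
  fixes \<mu> :: "'a::ab_group_add \<Rightarrow> real"
  assumes Z: "finite Z" and nonneg: "\<And>x. x \<in> Z \<Longrightarrow> \<mu> x \<ge> 0" and prob: "sum \<mu> Z = 1"
  defines "Q \<equiv> (\<Sum>x\<in>Z. (\<mu> x)\<^sup>2)"
  defines "E \<equiv> (\<Sum>x\<in>Z. \<Sum>y\<in>Z. \<mu> x * \<mu> y * autocorr \<mu> Z (x - y))"
  assumes QL: "Q > 0" "L > 0" "E = Q / L"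
  obtains D where "D \<subseteq> Z" "\<And>x. x \<in> D \<Longrightarrow> \<mu> x \<le> 8 * Q * L" "1 / (16 * L) \<le> sum \<mu> D"
    "real (card (diffset D)) \<le> 2 ^ 33 * L ^ 12 / Q"
proof -
  \<comment> \<open>Points heavier than \<open>T\<close> have mass at most
    \<open>Q / T = 1 / (8 * L)\<close>. The edges below have weight at least
    \<open>1 / (2 * L)\<close>, so removing these points at both ends leaves
    \<open>\<delta> = 1 / (4 * L)\<close>.\<close>
  define T where "T = 8 * Q * L"
  define P where "P = {d\<in>diffset Z. E / 2 \<le> autocorr \<mu> Z d}"
  define R where "R x y = (E / 2 \<le> autocorr \<mu> Z (x - y))" for x y
  define C where "C = {x\<in>Z. \<mu> x \<le> T}"
  define \<delta> where "\<delta> = 1 / (4 * L)"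
  have E0: "E > 0" and T0: "T > 0" and \<delta>0: "\<delta> > 0"
    using QL by (auto simp: T_def \<delta>_def)
  have finP: "finite P" using Z by (simp add: P_def finite_diffset)
  have finC: "finite C" and CZ: "C \<subseteq> Z" using Z by (auto simp: C_def)
  have nonnegC: "\<mu> c \<ge> 0" if "c \<in> C" for c using that CZ nonneg by blast
  have "real (card P) * (E / 2) = (\<Sum>d\<in>P. E / 2)" by simp
  also have "\<dots> \<le> (\<Sum>d\<in>P. autocorr \<mu> Z d)" by (intro sum_mono) (simp add: P_def)
  also have "\<dots> \<le> 1" using sum_autocorr_le[where Z = Z and \<mu> = \<mu>, OF nonneg finP] prob by simp
  finally have cP: "real (card P) \<le> 2 * L / Q"
    using QL by (simp add: field_simps)
  have sumZZ: "(\<Sum>x\<in>Z. \<Sum>y\<in>Z. \<mu> x * \<mu> y) = 1"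
    using prob by (simp add: sum_product[symmetric])
  \<comment> \<open>\<open>E\<close> is the mean of \<open>autocorr \<mu> Z (x - y)\<close>, which
    never exceeds \<open>Q\<close>; pairs with value below \<open>E / 2\<close> contribute at most
    half of it.\<close>
  have "E \<le> (\<Sum>x\<in>Z. \<Sum>y\<in>Z. \<mu> x * \<mu> y * of_bool (R x y) * Q + \<mu> x * \<mu> y * (E / 2))"
    unfolding E_def
  proof (intro sum_mono)
    fix x y
    assume "x \<in> Z" "y \<in> Z"
    then have 0: "0 \<le> \<mu> x * \<mu> y" using nonneg by simp
    have "autocorr \<mu> Z (x - y) \<le> of_bool (R x y) * Q + E / 2"
      using autocorr_le[OF Z, of \<mu> "x - y"] E0 by (auto simp: R_def Q_def)
    from mult_left_mono[OF this 0]
    show "\<mu> x * \<mu> y * autocorr \<mu> Z (x - y) \<le> \<mu> x * \<mu> y * of_bool (R x y) * Q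
        + \<mu> x * \<mu> y * ((\<Sum>x\<in>Z. \<Sum>y\<in>Z. \<mu> x * \<mu> y * autocorr \<mu> Z (x - y)) / 2)"
      unfolding E_def by (simp add: algebra_simps)
  qed
  also have "\<dots> = (\<Sum>x\<in>Z. \<Sum>y\<in>Z. \<mu> x * \<mu> y * of_bool (R x y)) * Q + (\<Sum>x\<in>Z. \<Sum>y\<in>Z. \<mu> x * \<mu> y) * (E / 2)"
    by (simp only: sum.distrib sum_distrib_right)
  finally have "E / 2 \<le> (\<Sum>x\<in>Z. \<Sum>y\<in>Z. \<mu> x * \<mu> y * of_bool (R x y)) * Q"
    using sumZZ by simp
  then have edges: "1 / (2 * L) \<le> (\<Sum>x\<in>Z. \<Sum>y\<in>Z. \<mu> x * \<mu> y * of_bool (R x y))"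
    using QL by (simp add: field_simps)
  have "sum \<mu> (Z - C) * T = (\<Sum>x\<in>Z - C. \<mu> x * T)" by (rule sum_distrib_right)
  also have "\<dots> \<le> (\<Sum>x\<in>Z - C. (\<mu> x)\<^sup>2)"
    using nonneg by (intro sum_mono) (auto simp: C_def power2_eq_square intro: mult_left_mono)
  also have "\<dots> \<le> Q"
    unfolding Q_def using Z by (intro sum_mono2) auto
  finally have large: "sum \<mu> (Z - C) \<le> 1 / (8 * L)"
    using QL by (simp add: T_def field_simps)
  have "(\<Sum>x\<in>Z. \<Sum>y\<in>Z. \<mu> x * \<mu> y * of_bool (R x y))
      \<le> (\<Sum>x\<in>Z. \<Sum>y\<in>Z. \<mu> x * \<mu> y * of_bool (x \<in> C \<and> y \<in> C \<and> R x y)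
          + (\<mu> x * of_bool (x \<notin> C)) * \<mu> y + \<mu> x * (\<mu> y * of_bool (y \<notin> C)))"
    using nonneg by (intro sum_mono) (auto simp: of_bool_def)
  also have "\<dots> = (\<Sum>x\<in>Z. \<Sum>y\<in>Z. \<mu> x * \<mu> y * of_bool (x \<in> C \<and> y \<in> C \<and> R x y))
      + (\<Sum>x\<in>Z. \<mu> x * of_bool (x \<notin> C)) * sum \<mu> Z + sum \<mu> Z * (\<Sum>x\<in>Z. \<mu> x * of_bool (x \<notin> C))"
    by (simp only: sum.distrib sum_product)
  also have "(\<Sum>x\<in>Z. \<mu> x * of_bool (x \<notin> C)) = sum \<mu> (Z - C)"
    using sum_Collect_eq_of_bool[OF Z, of \<mu> "\<lambda>x. x \<notin> C"] by (simp add: set_diff_eq)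
  also have "(\<Sum>x\<in>Z. \<Sum>y\<in>Z. \<mu> x * \<mu> y * of_bool (x \<in> C \<and> y \<in> C \<and> R x y))
      = (\<Sum>x\<in>C. \<Sum>y\<in>C. \<mu> x * \<mu> y * of_bool (R x y))"
  proof -
    have "(\<Sum>x\<in>C. \<Sum>y\<in>C. \<mu> x * \<mu> y * of_bool (R x y))
        = (\<Sum>x\<in>C. \<Sum>y\<in>Z. \<mu> x * \<mu> y * of_bool (x \<in> C \<and> y \<in> C \<and> R x y))"
      by (intro sum.cong refl sum.mono_neutral_cong_left Z CZ) auto
    also have "\<dots> = (\<Sum>x\<in>Z. \<Sum>y\<in>Z. \<mu> x * \<mu> y * of_bool (x \<in> C \<and> y \<in> C \<and> R x y))"
      by (intro sum.mono_neutral_left Z CZ) auto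
    finally show ?thesis by simp
  qed
  finally have "1 / (2 * L) \<le> (\<Sum>x\<in>C. \<Sum>y\<in>C. \<mu> x * \<mu> y * of_bool (R x y)) + 2 * (1 / (8 * L))"
    using edges large prob by simp
  then have edgesC: "\<delta> \<le> (\<Sum>x\<in>C. \<Sum>y\<in>C. \<mu> x * \<mu> y * of_bool (R x y))"
    using QL(2) by (simp add: \<delta>_def field_simps)
  have massC: "sum \<mu> C \<le> 1"
    using sum_mono2[OF Z CZ, of \<mu>] nonneg prob by auto
  define good where "good b b' \<longleftrightarrow> \<delta>\<^sup>2 / 16 \<le> sum \<mu> {c\<in>C. R b c \<and> R b' c}" for b b'
  obtain B D where BD: "B \<subseteq> C" "D \<subseteq> B" "\<delta> / 2 \<le> sum \<mu> B" "sum \<mu> B / 2 \<le> sum \<mu> D"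
    "\<And>b b'. b \<in> D \<Longrightarrow> b' \<in> D \<Longrightarrow> sum \<mu> B / 2 \<le> sum \<mu> {c\<in>B. good b c \<and> good b' c}"
    using dependent_random_choice[where \<mu> = \<mu> and R = R, OF finC nonnegC massC \<delta>0 edgesC] unfolding good_def by blast
  have finB: "finite B" and finD: "finite D"
    using BD finC finite_subset by metis+
  \<comment> \<open>\<open>b - c = (b - c') - (c - c')\<close> for every common neighbour
    \<open>c'\<close>, so a good pair has a difference with many representations in
    \<open>P - P\<close>. The same count one level up, with \<open>W\<close> for \<open>P\<close>,
    bounds \<open>D - D\<close>.\<close>
  define W where "W = {x\<in>diffset P. \<delta>\<^sup>2 / 16 / T \<le> real (card {q\<in>P \<times> P. fst q - snd q = x})}"
  have finW: "finite W" using finP by (simp add: W_def finite_diffset)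
  have in_P: "x - y \<in> P" if "x \<in> C" "y \<in> C" "R x y" for x y
    using that CZ by (auto simp: P_def R_def intro: diffsetI)
  have good_W: "b - c \<in> W" if bc: "b \<in> C" "c \<in> C" "good b c" for b c
  proof -
    define F where "F = {c'\<in>C. R b c' \<and> R c c'}"
    have "\<delta>\<^sup>2 / 16 \<le> sum \<mu> F" using bc(3) by (simp add: good_def F_def)
    then have *: "\<delta>\<^sup>2 / 16 / T \<le> real (card F)"
      by (intro mass_le_card_mult[OF T0]) (auto simp: F_def C_def)
    have "inj_on (\<lambda>c'. (b - c', c - c')) F" by (auto simp: inj_on_def)
    then have "card F \<le> card {q\<in>P \<times> P. fst q - snd q = b - c}"
      using finP bc by (intro card_inj_on_le) (auto simp: F_def intro!: in_P)
    moreover have "b - c \<in> diffset P"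
    proof -
      have "0 < \<delta>\<^sup>2 / 16 / T" using \<delta>0 T0 by simp
      then have "F \<noteq> {}" using * by auto
      then obtain c' where "c' \<in> F" by blast
      then have "b - c' \<in> P" "c - c' \<in> P" using bc by (auto simp: F_def intro!: in_P)
      from diffsetI[OF this] show ?thesis by simp
    qed
    ultimately show ?thesis using * by (simp add: W_def)
  qed
  have "real (card W) * (\<delta>\<^sup>2 / 16 / T) \<le> (real (card P))\<^sup>2"
    by (rule card_le_of_popular[OF finP finW]) (simp add: W_def)
  also have "\<dots> \<le> (2 * L / Q)\<^sup>2" using cP by (intro power_mono) auto
  finally have cW: "real (card W) \<le> 2 ^ 13 * L ^ 5 / Q"
    using QL(1,2) by (simp add: \<delta>_def T_def field_simps power2_eq_square eval_nat_numeral)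
  have DC: "D \<subseteq> C" using BD by blast
  have "real (card (diffset D)) * (sum \<mu> B / 2 / T) \<le> (real (card W))\<^sup>2"
  proof (rule card_le_of_popular[OF finW finite_diffset[OF finD]])
    fix x
    assume "x \<in> diffset D"
    then obtain b b' where b: "b \<in> D" "b' \<in> D" "x = b - b'" by (auto simp: diffset_def)
    define F where "F = {c\<in>B. good b c \<and> good b' c}"
    have *: "sum \<mu> B / 2 / T \<le> real (card F)"
      using BD(5)[OF b(1,2)] BD(1) by (intro mass_le_card_mult[OF T0]) (auto simp: F_def C_def)
    have "inj_on (\<lambda>c. (b - c, b' - c)) F" by (auto simp: inj_on_def)
    then have "card F \<le> card {q\<in>W \<times> W. fst q - snd q = x}"
      using finW b BD(1) DC by (intro card_inj_on_le) (auto simp: F_def intro!: good_W)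
    then show "sum \<mu> B / 2 / T \<le> real (card {q\<in>W \<times> W. fst q - snd q = x})"
      using * by linarith
  qed
  then have "real (card (diffset D)) * (\<delta> / 2 / 2 / T) \<le> (real (card W))\<^sup>2"
    using BD(3) T0 by (smt (verit) divide_right_mono mult_left_mono of_nat_0_le_iff)
  also have "\<dots> \<le> (2 ^ 13 * L ^ 5 / Q)\<^sup>2"
    using cW by (intro power_mono) auto
  finally have "real (card (diffset D)) \<le> 2 ^ 33 * L ^ 12 / Q"
    using QL(1,2) by (simp add: \<delta>_def T_def field_simps power2_eq_square eval_nat_numeral)
  moreover have "1 / (16 * L) \<le> sum \<mu> D"
    using BD(3,4) by (simp add: \<delta>_def)
  moreover have "\<mu> x \<le> 8 * Q * L" if "x \<in> D" for x
    using that DC by (auto simp: C_def T_def)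
  ultimately show ?thesis
    using that[of D] DC CZ by blast
qed

section \<open>Growth of sets of popular differences\<close>

text \<open>The set \<open>Y + D - D\<close>. The spare difference from \<open>D\<close> is what
  allows a shift by a popular difference to be absorbed.\<close>

definition thicken :: "'a::ab_group_add set \<Rightarrow> 'a set \<Rightarrow> 'a set" where
  "thicken D Y = (\<lambda>(t, e). t + e) ` (Y \<times> diffset D)"

lemma finite_thicken: "finite D \<Longrightarrow> finite Y \<Longrightarrow> finite (thicken D Y)"
  by (simp add: thicken_def finite_diffset)

lemma thickenI: "t \<in> Y \<Longrightarrow> e \<in> diffset D \<Longrightarrow> t + e \<in> thicken D Y"
  by (force simp: thicken_def)

text \<open>If \<open>s = y - z\<close>, then \<open>t + (d - d') + s = (t + (d - z)) + (y - d')\<close>, which splits the left-hand side into an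
  element of the thickened set and a difference in as many ways as \<open>s\<close> is a difference.\<close>

lemma card_thicken_shift:
  fixes D :: "'a::ab_group_add set"
  assumes "finite D" "finite Y" "finite S"
    and pop: "\<And>s. s \<in> S \<Longrightarrow> \<nu> \<le> real (card {q\<in>D \<times> D. fst q - snd q = s})"
  shows "real (card (thicken D ((\<lambda>(t, s). t + s) ` (Y \<times> S)))) * \<nu>
         \<le> real (card (thicken D Y)) * real (card (diffset D))"
proof -
  have "real (card (thicken D ((\<lambda>(t, s). t + s) ` (Y \<times> S)))) * \<nu>
      \<le> real (card (thicken D Y \<times> diffset D))"
  proof (rule card_fibre_bound[where g = "\<lambda>(x, e). x + e"])
    fix u
    assume "u \<in> thicken D ((\<lambda>(t, s). t + s) ` (Y \<times> S))"
    then obtain t s d d' where u: "u = t + s + (d - d')" "t \<in> Y" "s \<in> S" "d \<in> D" "d' \<in> D"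
      by (auto simp: thicken_def diffset_def)
    have "inj_on (\<lambda>(y, z). (t + (d - z), y - d')) {q\<in>D \<times> D. fst q - snd q = s}"
      by (auto simp: inj_on_def)
    then have "card {q\<in>D \<times> D. fst q - snd q = s}
        \<le> card {v \<in> thicken D Y \<times> diffset D. (case v of (x, e) \<Rightarrow> x + e) = u}"
      using assms(1,2) u
      by (intro card_inj_on_le) (auto simp: finite_thicken finite_diffset intro!: thickenI diffsetI)
    then show "\<nu> \<le> real (card {v \<in> thicken D Y \<times> diffset D. (case v of (x, e) \<Rightarrow> x + e) = u})"
      using pop[OF u(3)] by linarith
  qed (use assms in \<open>auto simp: finite_thicken finite_diffset\<close>)
  then show ?thesis by (simp add: card_cartesian_product)
qed

text \<open>Starting from \<open>thicken D {0} = D - D\<close>, each of \<open>2 * m\<close> shifts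
  by \<open>S\<close> costs a factor \<open>|D - D| / \<nu>\<close>; symmetry of \<open>S\<close>
  turns subtractions into such shifts. The outcome is a bound of Pluennecke type by plain
  counting.\<close>

lemma card_diffs_popular:
  fixes D :: "'a::ab_group_add set"
  assumes D: "finite D" "D \<noteq> {}" and S: "finite S" "\<And>s. s \<in> S \<Longrightarrow> - s \<in> S" and "\<nu> > 0"
    and pop: "\<And>s. s \<in> S \<Longrightarrow> \<nu> \<le> real (card {q\<in>D \<times> D. fst q - snd q = s})"
  shows "real (card (diffs m S)) \<le> (real (card (diffset D)) / \<nu>) ^ (2 * m) * real (card (diffset D))"
proof -
  define \<kappa> where "\<kappa> = real (card (diffset D)) / \<nu>"
  define sh where "sh Y = (\<lambda>(t, s). t + s) ` (Y \<times> S)" for Y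
  have \<kappa>: "\<kappa> \<ge> 0" using \<open>\<nu> > 0\<close> by (simp add: \<kappa>_def)
  have fsh: "finite (sh Y)" if "finite Y" for Y using that S(1) by (simp add: sh_def)
  have step: "real (card (thicken D (sh Y))) \<le> \<kappa> * real (card (thicken D Y))" if "finite Y" for Y
    using card_thicken_shift[OF D(1) that S(1) pop] \<open>\<nu> > 0\<close>
    by (simp add: \<kappa>_def sh_def field_simps)
  have "real (card (thicken D (diffs m S))) \<le> \<kappa> ^ (2 * m) * real (card (diffset D))"
  proof (induction m)
    case 0
    have "thicken D {0} = diffset D" by (auto simp: thicken_def image_iff)
    then show ?case by simp
  next
    case (Suc m)
    have fin: "finite (diffs m S)" using S(1) by (rule finite_diffs)
    have "diffs (Suc m) S \<subseteq> sh (sh (diffs m S))"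
    proof
      fix x
      assume "x \<in> diffs (Suc m) S"
      then obtain p a b where x: "x = p + a - b" "p \<in> diffs m S" "a \<in> S" "b \<in> S" by auto
      have "p + a \<in> sh (diffs m S)" using x by (force simp: sh_def)
      then have "(p + a) + (- b) \<in> sh (sh (diffs m S))"
        using S(2)[OF x(4)] unfolding sh_def[of "sh (diffs m S)"] by force
      then show "x \<in> sh (sh (diffs m S))" using x(1) by simp
    qed
    then have "thicken D (diffs (Suc m) S) \<subseteq> thicken D (sh (sh (diffs m S)))"
      unfolding thicken_def by (intro image_mono) auto
    then have "real (card (thicken D (diffs (Suc m) S))) \<le> real (card (thicken D (sh (sh (diffs m S)))))"
      using fsh fin D(1) by (intro of_nat_mono card_mono finite_thicken) auto
    also have "\<dots> \<le> \<kappa> * (\<kappa> * real (card (thicken D (diffs m S))))"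
      using step[OF fsh[OF fin]] mult_left_mono[OF step[OF fin] \<kappa>] by linarith
    also have "\<dots> \<le> \<kappa> * (\<kappa> * (\<kappa> ^ (2 * m) * real (card (diffset D))))"
      using Suc \<kappa> by (intro mult_left_mono)
    finally show ?case by (simp add: mult_ac)
  qed
  moreover have "card (diffs m S) \<le> card (thicken D (diffs m S))"
  proof (rule card_mono)
    obtain d where "d \<in> D" using D(2) by blast
    then have "0 \<in> diffset D" using diffsetI[of d D d] by simp
    then show "diffs m S \<subseteq> thicken D (diffs m S)"
      using thickenI[of _ "diffs m S" 0 D] by auto
  qed (use D S in \<open>auto intro: finite_thicken finite_diffs\<close>)
  ultimately show ?thesis unfolding \<kappa>_def by linarith
qed

lemma autocorr_uminus: "autocorr \<mu> Z (- d) = autocorr \<mu> Z d"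
proof -
  have "autocorr \<mu> Z (- d) = (\<Sum>y\<in>Z. \<Sum>x\<in>Z. \<mu> x * \<mu> y * of_bool (x - y = - d))"
    unfolding autocorr_def by (rule sum.swap)
  also have "\<dots> = autocorr \<mu> Z d"
    unfolding autocorr_def
    by (intro sum.cong refl) (simp add: mult.commute equation_minus_iff[of _ d] eq_commute[of d])
  finally show ?thesis .
qed

text \<open>For \<open>D\<close> from \<open>small_diffset\<close> only \<open>D - D\<close> is
  controlled, whereas its popular differences \<open>S\<close> have small iterated difference sets
  of every order. Averaging over \<open>v \<in> D\<close> finds a translate of \<open>S\<close>
  holding a quarter of the mass of \<open>D\<close>.\<close>

lemma structured_translate:
  fixes \<mu> :: "'a::ab_group_add \<Rightarrow> real"
  assumes Z: "finite Z" and nonneg: "\<And>x. x \<in> Z \<Longrightarrow> \<mu> x \<ge> 0" and prob: "sum \<mu> Z = 1"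
  defines "Q \<equiv> (\<Sum>x\<in>Z. (\<mu> x)\<^sup>2)"
  defines "E \<equiv> (\<Sum>x\<in>Z. \<Sum>y\<in>Z. \<mu> x * \<mu> y * autocorr \<mu> Z (x - y))"
  assumes QL: "Q > 0" "L > 0" "E = Q / L"
  obtains S v where "finite S" "1 / (64 * L) \<le> sum \<mu> {x\<in>Z. x - v \<in> S}"
    "\<And>m. real (card (diffs m S)) \<le> (2 ^ 81 * L ^ 28) ^ (2 * m) * (2 ^ 33 * L ^ 12 / Q)"
proof -
  obtain D where D: "D \<subseteq> Z" "\<And>x. x \<in> D \<Longrightarrow> \<mu> x \<le> 8 * Q * L" "1 / (16 * L) \<le> sum \<mu> D"
    "real (card (diffset D)) \<le> 2 ^ 33 * L ^ 12 / Q"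
    using small_diffset[where \<mu> = \<mu>, OF Z nonneg prob QL[unfolded Q_def E_def]] unfolding Q_def by blast
  define T where "T = 8 * Q * L"
  define M where "M = sum \<mu> D"
  define n where "n = real (card (diffset D))"
  \<comment> \<open>Half the average of \<open>autocorr \<mu> D\<close> over \<open>D - D\<close>,
    so the differences below it carry at most half of the total \<open>M\<^sup>2\<close>.\<close>
  define \<sigma> where "\<sigma> = M\<^sup>2 / (2 * n)"
  define S where "S = {s\<in>diffset D. \<sigma> \<le> autocorr \<mu> D s}"
  \<comment> \<open>A pair from \<open>D \<times> D\<close> weighs at most \<open>T\<^sup>2\<close>,
    so weight \<open>\<sigma>\<close> requires at least \<open>\<sigma> / T\<^sup>2\<close>
    pairs.\<close>
  define \<nu> where "\<nu> = \<sigma> / T\<^sup>2"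
  have T0: "T > 0" using QL by (simp add: T_def)
  have finD: "finite D" using D(1) Z finite_subset by blast
  have nonnegD: "\<mu> x \<ge> 0" if "x \<in> D" for x using that D(1) nonneg by blast
  have "0 < 1 / (16 * L)" using QL by simp
  then have M0: "M > 0" using D(3) unfolding M_def by linarith
  then have ne: "D \<noteq> {}" by (auto simp: M_def)
  then have n1: "n > 0"
    using finite_diffset[OF finD] by (auto simp: n_def card_gt_0_iff diffset_def)
  have finS: "finite S" using finite_diffset[OF finD] by (simp add: S_def)
  have "(\<Sum>d\<in>diffset D. autocorr \<mu> D d) = (\<Sum>x\<in>D. \<Sum>y\<in>D. \<mu> x * \<mu> y)"
    unfolding sum_autocorr[OF finite_diffset[OF finD]] by (intro sum.cong refl) (simp add: diffsetI)
  then have "(\<Sum>d\<in>diffset D. autocorr \<mu> D d) = M\<^sup>2"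
    by (simp add: M_def power2_eq_square sum_product)
  moreover have "(\<Sum>d\<in>diffset D. autocorr \<mu> D d) = (\<Sum>d\<in>diffset D - S. autocorr \<mu> D d) + (\<Sum>d\<in>S. autocorr \<mu> D d)"
    by (rule sum.subset_diff) (auto simp: S_def finite_diffset finD)
  moreover have "(\<Sum>d\<in>diffset D - S. autocorr \<mu> D d) \<le> M\<^sup>2 / 2"
  proof -
    have "(\<Sum>d\<in>diffset D - S. autocorr \<mu> D d) \<le> (\<Sum>d\<in>diffset D - S. \<sigma>)"
      by (intro sum_mono) (auto simp: S_def)
    also have "\<dots> \<le> (\<Sum>d\<in>diffset D. \<sigma>)"
      using finD n1 by (intro sum_mono2) (auto simp: finite_diffset \<sigma>_def)
    also have "\<dots> = M\<^sup>2 / 2" using n1 by (simp add: \<sigma>_def n_def)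
    finally show ?thesis .
  qed
  ultimately have half: "M\<^sup>2 / 2 \<le> (\<Sum>d\<in>S. autocorr \<mu> D d)" by linarith
  have "(\<Sum>d\<in>S. autocorr \<mu> D d) = (\<Sum>z\<in>D. \<Sum>y\<in>D. \<mu> y * \<mu> z * of_bool (y - z \<in> S))"
    unfolding sum_autocorr[OF finS] by (rule sum.swap)
  also have "\<dots> = (\<Sum>z\<in>D. \<mu> z * sum \<mu> {y\<in>D. y - z \<in> S})"
    by (simp only: sum_Collect_eq_of_bool[OF finD] sum_distrib_left) (simp only: mult_ac)
  finally have "M\<^sup>2 / 4 < (\<Sum>z\<in>D. \<mu> z * sum \<mu> {y\<in>D. y - z \<in> S})"
    using half zero_less_power[OF M0, of 2] by linarith
  moreover have "sum \<mu> D * (M / 4) \<le> M\<^sup>2 / 4"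
    by (simp add: M_def power2_eq_square)
  ultimately obtain v where v: "v \<in> D" "M / 4 < sum \<mu> {y\<in>D. y - v \<in> S}"
    using mass_exists_ge[where \<mu> = \<mu> and x = "\<lambda>z. sum \<mu> {y\<in>D. y - z \<in> S}", OF finD nonnegD] by blast
  have "sum \<mu> {y\<in>D. y - v \<in> S} \<le> sum \<mu> {x\<in>Z. x - v \<in> S}"
    using Z D(1) nonneg by (intro sum_mono2) auto
  then have mass: "1 / (64 * L) \<le> sum \<mu> {x\<in>Z. x - v \<in> S}"
    using v(2) D(3) unfolding M_def by simp
  have \<nu>0: "\<nu> > 0" using M0 n1 T0 by (simp add: \<nu>_def \<sigma>_def)
  have pop: "\<nu> \<le> real (card {q\<in>D \<times> D. fst q - snd q = s})" if "s \<in> S" for s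
  proof -
    have "\<sigma> \<le> (\<Sum>q\<in>D \<times> D. \<mu> (fst q) * \<mu> (snd q) * of_bool (fst q - snd q = s))"
      using that by (simp add: S_def autocorr_def sum.cartesian_product case_prod_beta)
    also have "\<dots> = (\<Sum>q\<in>{q\<in>D \<times> D. fst q - snd q = s}. \<mu> (fst q) * \<mu> (snd q))"
      by (rule sum_Collect_eq_of_bool[symmetric]) (use finD in simp)
    finally have "\<sigma> \<le> (\<Sum>q\<in>{q\<in>D \<times> D. fst q - snd q = s}. \<mu> (fst q) * \<mu> (snd q))" .
    moreover have "\<mu> (fst q) * \<mu> (snd q) \<le> T\<^sup>2" if "q \<in> {q\<in>D \<times> D. fst q - snd q = s}" for q
      unfolding power2_eq_square using that D(2)[folded T_def] nonnegD T0
      by (intro mult_mono) auto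
    ultimately show ?thesis
      unfolding \<nu>_def using T0
      by (intro mass_le_card_mult[where \<mu> = "\<lambda>q. \<mu> (fst q) * \<mu> (snd q)"]) auto
  qed
  have sym: "- s \<in> S" if "s \<in> S" for s
  proof -
    have "- s \<in> diffset D" using that by (force simp: S_def diffset_def)
    then show ?thesis using that by (simp add: S_def autocorr_uminus)
  qed
  have nu_eq: "n / \<nu> = 2 * n\<^sup>2 * T\<^sup>2 / M\<^sup>2"
    using n1 T0 M0 by (simp add: \<nu>_def \<sigma>_def power2_eq_square)
  have "n / \<nu> \<le> 2 * (2 ^ 33 * L ^ 12 / Q)\<^sup>2 * T\<^sup>2 / (1 / (16 * L))\<^sup>2"
    unfolding nu_eq using D(3,4) QL n1 M0 unfolding n_def[symmetric] M_def[symmetric]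
    by (intro frac_le mult_right_mono mult_left_mono power_mono) auto
  also have "\<dots> = 2 ^ 81 * L ^ 28"
    using QL(1,2) by (simp add: T_def field_simps power2_eq_square eval_nat_numeral)
  finally have \<kappa>: "n / \<nu> \<le> 2 ^ 81 * L ^ 28" .
  have "real (card (diffs m S)) \<le> (2 ^ 81 * L ^ 28) ^ (2 * m) * (2 ^ 33 * L ^ 12 / Q)" for m
  proof -
    have "real (card (diffs m S)) \<le> (n / \<nu>) ^ (2 * m) * n"
      unfolding n_def by (rule card_diffs_popular[OF finD ne finS sym \<nu>0 pop])
    also have "\<dots> \<le> (2 ^ 81 * L ^ 28) ^ (2 * m) * (2 ^ 33 * L ^ 12 / Q)"
      using \<kappa> D(4) \<nu>0 n1 QL(2) by (intro mult_mono power_mono) (auto simp: n_def)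
    finally show ?thesis .
  qed
  then show ?thesis using that[OF finS mass] by blast
qed

section \<open>Energies and random sums\<close>

abbreviation words :: "nat \<Rightarrow> 'a set \<Rightarrow> 'a list set" where
  "words t A \<equiv> {xs. set xs \<subseteq> A \<and> length xs = t}"

lemma sum_words_Suc:
  "(\<Sum>w\<in>words (Suc n) A. F w) = (\<Sum>a\<in>A. \<Sum>w\<in>words n A. F (a # w))"
proof -
  have "words (Suc n) A = (\<lambda>(a, w). a # w) ` (A \<times> words n A)"
    by (auto simp: length_Suc_conv image_iff)
  then have "(\<Sum>w\<in>words (Suc n) A. F w) = (\<Sum>(a, w)\<in>A \<times> words n A. F (a # w))"
    by (simp add: sum.reindex inj_on_def case_prod_beta)
  then show ?thesis by (simp only: sum.cartesian_product)
qed

lemma sum_words_add: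
  "(\<Sum>w\<in>words (m + n) A. F w) = (\<Sum>u\<in>words m A. \<Sum>w\<in>words n A. F (u @ w))"
proof (induction m arbitrary: F)
  case 0
  have "words 0 A = {[]}" by auto
  then show ?case by simp
next
  case (Suc m)
  show ?case
    unfolding add_Suc sum_words_Suc Suc append_Cons ..
qed

lemma energy_eq:
  assumes "finite A"
  shows "real (energy t A) = (\<Sum>u\<in>words t A. \<Sum>v\<in>words t A. of_bool (sum_list u = sum_list v))"
proof -
  have fin: "finite (words (t + t) A)" using assms by (rule finite_lists_length_eq)
  have "energy t A = card {xs\<in>words (t + t) A. sum_list (take t xs) = sum_list (drop t xs)}"
    unfolding energy_def by (intro arg_cong[where f = card]) auto
  also have "real \<dots> = (\<Sum>xs\<in>words (t + t) A. of_bool (sum_list (take t xs) = sum_list (drop t xs)))"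
    using sum_Collect_eq_of_bool[OF fin, of "\<lambda>_. 1"] by simp
  also have "\<dots> = (\<Sum>u\<in>words t A. \<Sum>v\<in>words t A. of_bool (sum_list u = sum_list v))"
    unfolding sum_words_add by (intro sum.cong refl) auto
  finally show ?thesis .
qed

text \<open>The law of a sum of \<open>t\<close> independent uniform elements of
  \<open>A\<close>.\<close>

definition sumdist :: "nat \<Rightarrow> real set \<Rightarrow> real \<Rightarrow> real" where
  "sumdist t A x = real (card {u\<in>words t A. sum_list u = x}) / real (card A) ^ t"

lemma sum_sumdist:
  assumes "finite A"
  shows "(\<Sum>x\<in>sum_list ` words t A. sumdist t A x * F x) = (\<Sum>u\<in>words t A. F (sum_list u)) / real (card A) ^ t"
proof -
  have fin: "finite (words t A)" using assms by (rule finite_lists_length_eq)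
  have "(\<Sum>u\<in>words t A. F (sum_list u))
      = (\<Sum>x\<in>sum_list ` words t A. \<Sum>u\<in>{u\<in>words t A. sum_list u = x}. F (sum_list u))"
    by (rule sum.image_gen[OF fin])
  also have "\<dots> = (\<Sum>x\<in>sum_list ` words t A. real (card {u\<in>words t A. sum_list u = x}) * F x)"
    by (intro sum.cong refl) simp
  finally show ?thesis
    by (simp add: sumdist_def sum_divide_distrib)
qed

lemma autocorr_sumdist:
  assumes "finite A"
  shows "autocorr (sumdist t A) (sum_list ` words t A) d
    = (\<Sum>u\<in>words t A. \<Sum>v\<in>words t A. of_bool (sum_list u - sum_list v = d)) / real (card A) ^ (2 * t)"
proof -
  have "autocorr (sumdist t A) (sum_list ` words t A) d
      = (\<Sum>x\<in>sum_list ` words t A. sumdist t A x * (\<Sum>y\<in>sum_list ` words t A. sumdist t A y * of_bool (x - y = d)))"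
    by (simp only: autocorr_def sum_distrib_left mult.assoc)
  then show ?thesis
    unfolding sum_sumdist[OF assms]
    by (simp add: sum_divide_distrib mult_2 power_add)
qed


text \<open>By \<open>autocorr_le\<close> zero is the most popular difference of two random sums,
  and the energy counts its representations.\<close>

lemma sum_differences_le_energy:
  assumes "finite A" "A \<noteq> {}"
  shows "(\<Sum>u\<in>words t A. \<Sum>v\<in>words t A. of_bool (sum_list u - sum_list v = d)) \<le> real (energy t A)"
proof -
  have fin: "finite (words t A)" using assms(1) by (rule finite_lists_length_eq)
  have N: "real (card A) ^ (2 * t) > 0" using assms by (simp add: card_gt_0_iff)
  have "autocorr (sumdist t A) (sum_list ` words t A) d \<le> (\<Sum>x\<in>sum_list ` words t A. (sumdist t A x)\<^sup>2)"
    using fin by (intro autocorr_le) auto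
  also have "\<dots> = autocorr (sumdist t A) (sum_list ` words t A) 0"
    using fin by (simp add: autocorr_def of_bool_def power2_eq_square if_distrib cong: if_cong)
  finally have "(\<Sum>u\<in>words t A. \<Sum>v\<in>words t A. of_bool (sum_list u - sum_list v = d)) / real (card A) ^ (2 * t)
      \<le> (\<Sum>u\<in>words t A. \<Sum>v\<in>words t A. of_bool (sum_list u - sum_list v = 0)) / real (card A) ^ (2 * t)"
    unfolding autocorr_sumdist[OF assms(1)] .
  then have "(\<Sum>u\<in>words t A. \<Sum>v\<in>words t A. of_bool (sum_list u - sum_list v = d))
      \<le> (\<Sum>u\<in>words t A. \<Sum>v\<in>words t A. of_bool (sum_list u - sum_list v = 0) :: real)"
    using N unfolding divide_le_cancel by blast
  then show ?thesis
    unfolding energy_eq[OF assms(1)] by simp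
qed

text \<open>Once the leading entries \<open>a\<close> and \<open>b\<close> of the two halves are
  fixed, the other entries represent \<open>b - a\<close> as a difference of sums of
  \<open>t\<close> elements.\<close>

lemma energy_Suc_le:
  assumes "finite A" "A \<noteq> {}"
  shows "real (energy (Suc t) A) \<le> (real (card A))\<^sup>2 * real (energy t A)"
proof -
  have "real (energy (Suc t) A)
      = (\<Sum>a\<in>A. \<Sum>u\<in>words t A. \<Sum>b\<in>A. \<Sum>v\<in>words t A. of_bool (sum_list (a # u) = sum_list (b # v)))"
    unfolding energy_eq[OF assms(1)] sum_words_Suc ..
  also have "\<dots> = (\<Sum>a\<in>A. \<Sum>b\<in>A. \<Sum>u\<in>words t A. \<Sum>v\<in>words t A. of_bool (sum_list u - sum_list v = b - a))"
  proof (rule sum.cong[OF refl])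
    fix a
    have "(\<Sum>u\<in>words t A. \<Sum>b\<in>A. \<Sum>v\<in>words t A. of_bool (sum_list (a # u) = sum_list (b # v)))
        = (\<Sum>b\<in>A. \<Sum>u\<in>words t A. \<Sum>v\<in>words t A. of_bool (sum_list (a # u) = sum_list (b # v)))"
      by (rule sum.swap)
    also have "\<dots> = (\<Sum>b\<in>A. \<Sum>u\<in>words t A. \<Sum>v\<in>words t A. of_bool (sum_list u - sum_list v = b - a))"
      by (intro sum.cong refl arg_cong[where f = of_bool]) auto
    finally show "(\<Sum>u\<in>words t A. \<Sum>b\<in>A. \<Sum>v\<in>words t A. of_bool (sum_list (a # u) = sum_list (b # v)))
        = (\<Sum>b\<in>A. \<Sum>u\<in>words t A. \<Sum>v\<in>words t A. of_bool (sum_list u - sum_list v = b - a) :: real)" .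
  qed
  also have "\<dots> \<le> (\<Sum>a\<in>A. \<Sum>b\<in>A. real (energy t A))"
    by (intro sum_mono sum_differences_le_energy assms)
  finally show ?thesis by (simp add: power2_eq_square)
qed

lemma energy_1:
  assumes "finite A"
  shows "energy 1 A = card A"
proof -
  have 0: "words 0 A = {[]}" by auto
  have "real (energy 1 A) = (\<Sum>a\<in>A. \<Sum>b\<in>A. of_bool (a = b))"
    unfolding energy_eq[OF assms] One_nat_def sum_words_Suc 0 by simp
  also have "\<dots> = real (card A)"
    using assms by (simp add: of_bool_def)
  finally show ?thesis by simp
qed

text \<open>The equation \<open>w - z = u - v\<close> between four sums of length \<open>t\<close>
  is regrouped as \<open>u + z = v + w\<close>, an equation between two sums of length
  \<open>2 * t\<close>.\<close>

lemma energy_double: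
  fixes t :: nat
  assumes "finite A"
  defines "\<mu> \<equiv> sumdist t A" and "Z \<equiv> sum_list ` words t A"
  shows "(\<Sum>x\<in>Z. \<Sum>y\<in>Z. \<mu> x * \<mu> y * autocorr \<mu> Z (x - y)) = real (energy (2 * t) A) / real (card A) ^ (4 * t)"
proof -
  let ?W = "words t A"
  let ?N = "real (card A)"
  have "(\<Sum>x\<in>Z. \<Sum>y\<in>Z. \<mu> x * \<mu> y * autocorr \<mu> Z (x - y))
      = (\<Sum>x\<in>Z. \<mu> x * (\<Sum>y\<in>Z. \<mu> y * autocorr \<mu> Z (x - y)))"
    by (simp only: sum_distrib_left mult.assoc)
  also have "\<dots> = (\<Sum>u\<in>?W. (\<Sum>v\<in>?W. autocorr \<mu> Z (sum_list u - sum_list v)) / ?N ^ t) / ?N ^ t"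
    unfolding \<mu>_def Z_def sum_sumdist[OF assms(1)] ..
  also have "\<dots> = (\<Sum>u\<in>?W. \<Sum>v\<in>?W. autocorr \<mu> Z (sum_list u - sum_list v)) / ?N ^ (2 * t)"
    by (simp add: sum_divide_distrib mult_2 power_add)
  also have "\<dots> = (\<Sum>u\<in>?W. \<Sum>v\<in>?W. \<Sum>w\<in>?W. \<Sum>z\<in>?W.
      of_bool (sum_list w - sum_list z = sum_list u - sum_list v)) / ?N ^ (2 * t) / ?N ^ (2 * t)"
    unfolding \<mu>_def Z_def autocorr_sumdist[OF assms(1)] by (simp add: sum_divide_distrib)
  also have "\<dots> = (\<Sum>u\<in>?W. \<Sum>v\<in>?W. \<Sum>w\<in>?W. \<Sum>z\<in>?W.
      of_bool (sum_list w - sum_list z = sum_list u - sum_list v)) / ?N ^ (4 * t)"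
    by (simp add: power_add[symmetric])
  also have "(\<Sum>u\<in>?W. \<Sum>v\<in>?W. \<Sum>w\<in>?W. \<Sum>z\<in>?W. of_bool (sum_list w - sum_list z = sum_list u - sum_list v))
      = (\<Sum>u\<in>?W. \<Sum>z\<in>?W. \<Sum>v\<in>?W. \<Sum>w\<in>?W. of_bool (sum_list (u @ z) = sum_list (v @ w)) :: real)"
  proof (rule sum.cong[OF refl])
    fix u
    have "(\<Sum>v\<in>?W. \<Sum>w\<in>?W. \<Sum>z\<in>?W. of_bool (sum_list w - sum_list z = sum_list u - sum_list v))
        = (\<Sum>v\<in>?W. \<Sum>w\<in>?W. \<Sum>z\<in>?W. of_bool (sum_list (u @ z) = sum_list (v @ w)) :: real)"
      by (intro sum.cong refl arg_cong[where f = of_bool]) auto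
    also have "\<dots> = (\<Sum>v\<in>?W. \<Sum>z\<in>?W. \<Sum>w\<in>?W. of_bool (sum_list (u @ z) = sum_list (v @ w)))"
      by (intro sum.cong refl sum.swap)
    also have "\<dots> = (\<Sum>z\<in>?W. \<Sum>v\<in>?W. \<Sum>w\<in>?W. of_bool (sum_list (u @ z) = sum_list (v @ w)))"
      by (rule sum.swap)
    finally show "(\<Sum>v\<in>?W. \<Sum>w\<in>?W. \<Sum>z\<in>?W. of_bool (sum_list w - sum_list z = sum_list u - sum_list v))
        = (\<Sum>z\<in>?W. \<Sum>v\<in>?W. \<Sum>w\<in>?W. of_bool (sum_list (u @ z) = sum_list (v @ w)) :: real)" .
  qed
  also have "\<dots> = real (energy (t + t) A)"
    unfolding energy_eq[OF assms(1)] sum_words_add ..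
  finally show ?thesis by (simp add: mult_2)
qed

lemma diffs_translate_subset:
  assumes "\<And>a. a \<in> X \<Longrightarrow> a + v \<in> S"
  shows "diffs m X \<subseteq> diffs m S"
proof (induction m)
  case (Suc m)
  show ?case
  proof
    fix x
    assume "x \<in> diffs (Suc m) X"
    then obtain p a b where "x = p + (a + v) - (b + v)" "p \<in> diffs m X" "a \<in> X" "b \<in> X" by auto
    then show "x \<in> diffs (Suc m) S"
      using Suc assms unfolding diffs.simps by blast
  qed
qed simp

text \<open>The quantity \<open>q t\<close>: the probability that two independent sums of
  \<open>t\<close> uniform elements of \<open>A\<close> agree.\<close>

definition avg_energy :: "nat \<Rightarrow> real set \<Rightarrow> real" where
  "avg_energy t A = real (energy t A) / real (card A) ^ (2 * t)"

lemma avg_energy_pos: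
  assumes "finite A" "A \<noteq> {}"
  shows "avg_energy t A > 0"
proof -
  obtain a where a: "a \<in> A" using assms(2) by blast
  have "{xs. length xs = 2 * t \<and> set xs \<subseteq> A \<and> sum_list (take t xs) = sum_list (drop t xs)} \<subseteq> words (2 * t) A"
    by auto
  then have "finite {xs. length xs = 2 * t \<and> set xs \<subseteq> A \<and> sum_list (take t xs) = sum_list (drop t xs)}"
    using finite_lists_length_eq[OF assms(1)] by (rule finite_subset)
  moreover have "replicate (2 * t) a
      \<in> {xs. length xs = 2 * t \<and> set xs \<subseteq> A \<and> sum_list (take t xs) = sum_list (drop t xs)}"
    using a by (auto simp: min_def)
  ultimately have "energy t A > 0"
    unfolding energy_def by (subst card_gt_0_iff) blast
  then show ?thesis
    using assms by (simp add: avg_energy_def card_gt_0_iff)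
qed

text \<open>For the law of random sums \<open>structured_translate\<close> has
  \<open>Q = q t\<close> and \<open>E = q (2t)\<close>, whence this \<open>L\<close>. Fixing all
  summands but one, with a choice found by averaging, turns a translate of \<open>S\<close> of mass
  \<open>1 / (64 * L)\<close> into a subset of \<open>A\<close> of at least that density.\<close>

lemma energy_structure:
  fixes A :: "real set"
  assumes A: "finite A" "A \<noteq> {}" and "t \<ge> 1" and L: "L = avg_energy t A / avg_energy (2 * t) A"
  obtains A' where "A' \<subseteq> A" "real (card A) / (64 * L) \<le> real (card A')"
    "\<And>m. real (card (diffs m A')) \<le> (2 ^ 81 * L ^ 28) ^ (2 * m) * (2 ^ 33 * L ^ 12 / avg_energy t A)"
proof -
  define \<mu> where "\<mu> = sumdist t A"
  define Z where "Z = sum_list ` words t A"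
  let ?N = "real (card A)"
  have N: "?N > 0" using A by (simp add: card_gt_0_iff)
  have finW: "finite (words t A)" using A(1) by (rule finite_lists_length_eq)
  have finZ: "finite Z" using finW by (simp add: Z_def)
  have nonneg: "\<mu> x \<ge> 0" for x by (simp add: \<mu>_def sumdist_def)
  have "sum \<mu> Z = (\<Sum>u\<in>words t A. 1) / ?N ^ t"
    using sum_sumdist[OF A(1), of t "\<lambda>_. 1"] by (simp add: \<mu>_def Z_def)
  also have "\<dots> = 1" using N card_lists_length_eq[OF A(1), of t] by simp
  finally have prob: "sum \<mu> Z = 1" .
  have "(\<Sum>x\<in>Z. (\<mu> x)\<^sup>2) = autocorr \<mu> Z 0"
    using finZ by (simp add: autocorr_def of_bool_def power2_eq_square if_distrib cong: if_cong)
  then have Q: "(\<Sum>x\<in>Z. (\<mu> x)\<^sup>2) = avg_energy t A"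
    unfolding \<mu>_def Z_def autocorr_sumdist[OF A(1)] avg_energy_def energy_eq[OF A(1)] by simp
  have E: "(\<Sum>x\<in>Z. \<Sum>y\<in>Z. \<mu> x * \<mu> y * autocorr \<mu> Z (x - y)) = avg_energy (2 * t) A"
    unfolding \<mu>_def Z_def energy_double[OF A(1)] avg_energy_def by simp
  have pos: "avg_energy t A > 0" "avg_energy (2 * t) A > 0" using avg_energy_pos[OF A] by auto
  then have "L > 0" by (simp add: L)
  obtain S v where S: "finite S" "1 / (64 * L) \<le> sum \<mu> {x\<in>Z. x - v \<in> S}"
    "\<And>m. real (card (diffs m S)) \<le> (2 ^ 81 * L ^ 28) ^ (2 * m) * (2 ^ 33 * L ^ 12 / avg_energy t A)"
  proof (rule structured_translate[where \<mu> = \<mu> and L = L, OF finZ nonneg prob, unfolded Q E])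
    show "avg_energy (2 * t) A = avg_energy t A / L" using pos by (simp add: L)
  qed (use pos \<open>L > 0\<close> in auto)
  obtain n where n: "t = Suc n" using \<open>t \<ge> 1\<close> by (cases t) auto
  have "sum \<mu> {x\<in>Z. x - v \<in> S} = (\<Sum>x\<in>Z. \<mu> x * of_bool (x - v \<in> S))"
    by (rule sum_Collect_eq_of_bool[OF finZ])
  also have "\<dots> = (\<Sum>u\<in>words t A. of_bool (sum_list u - v \<in> S)) / ?N ^ t"
    unfolding \<mu>_def Z_def by (rule sum_sumdist[OF A(1)])
  also have "\<dots> = (\<Sum>a\<in>A. \<Sum>w\<in>words n A. of_bool (a + (sum_list w - v) \<in> S)) / ?N ^ t"
    unfolding n sum_words_Suc by (simp add: add_diff_eq)
  also have "\<dots> = (\<Sum>w\<in>words n A. \<Sum>a\<in>A. of_bool (a + (sum_list w - v) \<in> S)) / ?N ^ t"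
    by (subst sum.swap) (rule refl)
  also have "\<dots> = (\<Sum>w\<in>words n A. real (card {a\<in>A. a + (sum_list w - v) \<in> S})) / ?N ^ t"
    using sum_Collect_eq_of_bool[OF A(1), of "\<lambda>_. 1"] by simp
  finally have "1 / (64 * L) \<le> (\<Sum>w\<in>words n A. real (card {a\<in>A. a + (sum_list w - v) \<in> S})) / ?N ^ t"
    using S(2) by simp
  then have big: "?N ^ t / (64 * L) \<le> (\<Sum>w\<in>words n A. real (card {a\<in>A. a + (sum_list w - v) \<in> S}))"
    using N by (simp add: pos_le_divide_eq)
  have "card (words n A) > 0"
    using card_lists_length_eq[OF A(1), of n] N by simp
  then have ne: "words n A \<noteq> {}" by (metis card.empty less_irrefl)
  have "\<exists>w\<in>words n A. ?N / (64 * L) \<le> real (card {a\<in>A. a + (sum_list w - v) \<in> S})"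
  proof (rule ccontr)
    assume "\<not> ?thesis"
    then have "(\<Sum>w\<in>words n A. real (card {a\<in>A. a + (sum_list w - v) \<in> S})) < (\<Sum>w\<in>words n A. ?N / (64 * L))"
      using finite_lists_length_eq[OF A(1), of n] ne by (intro sum_strict_mono) (auto simp: not_le)
    also have "\<dots> = ?N ^ t / (64 * L)"
      using card_lists_length_eq[OF A(1), of n] by (simp add: n)
    finally show False using big by simp
  qed
  then obtain w where w: "?N / (64 * L) \<le> real (card {a\<in>A. a + (sum_list w - v) \<in> S})" by blast
  show ?thesis
  proof (rule that[OF _ w])
    fix m
    have "diffs m {a\<in>A. a + (sum_list w - v) \<in> S} \<subseteq> diffs m S"
      by (rule diffs_translate_subset[where v = "sum_list w - v"]) simp
    then have "card (diffs m {a\<in>A. a + (sum_list w - v) \<in> S}) \<le> card (diffs m S)"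
      using S(1) by (intro card_mono finite_diffs)
    then show "real (card (diffs m {a\<in>A. a + (sum_list w - v) \<in> S}))
        \<le> (2 ^ 81 * L ^ 28) ^ (2 * m) * (2 ^ 33 * L ^ 12 / avg_energy t A)"
      using S(3)[of m] by linarith
  qed auto
qed

section \<open>The inequality for doubled length and its iteration\<close>

definition doubling :: "real set \<Rightarrow> real" where
  "doubling I = real (card (two_minus I)) / real (card I)"

lemma doubling_ge_1:
  assumes "finite I" "I \<noteq> {}"
  shows "doubling I \<ge> 1"
  using card_two_minus_ge[OF assms(1)] assms by (simp add: doubling_def card_gt_0_iff le_divide_eq_1)

text \<open>\<open>card_diffs_kconvex\<close> bounds \<open>diffs m A'\<close> from below and
  \<open>energy_structure\<close> from above. With \<open>X\<close> and \<open>Y\<close> the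
  normalised energies at \<open>t\<close> and \<open>2 * t\<close>, the comparison reads
  \<open>X \<le> C * K ^ p * (X / Y) ^ q\<close> and is solved for \<open>Y\<close>.\<close>

lemma avg_energy_kconvex_double:
  assumes "k \<ge> 1"
  obtains C :: real and p q :: nat where "C \<ge> 1" "q \<ge> 3"
    "\<And>J f I t. is_interval J \<Longrightarrow> kconvex_on k J f \<Longrightarrow> finite I \<Longrightarrow> I \<noteq> {} \<Longrightarrow> I \<subseteq> J \<Longrightarrow> t \<ge> 1 \<Longrightarrow>
      avg_energy (2 * t) (f ` I) * real (card I) ^ k
      \<le> C * doubling I ^ p * (avg_energy t (f ` I) * real (card I) ^ k) powr (1 - 1 / real q)"
proof -
  obtain m p :: nat and C0 :: real where C0: "C0 \<ge> 1" and
    sumset: "\<And>J f I. is_interval J \<Longrightarrow> kconvex_on k J f \<Longrightarrow> finite I \<Longrightarrow> I \<noteq> {} \<Longrightarrow> I \<subseteq> J \<Longrightarrow>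
      real (card I) ^ k \<le> C0 * doubling I ^ p * real (card (diffs m (f ` I)))"
    by (rule card_diffs_kconvex[OF assms, folded doubling_def]) (rule that)
  define C where "C = 64 ^ k * (C0 * 64 ^ p * (2 ^ 81) ^ (2 * m) * 2 ^ 33)"
  \<comment> \<open>The total power of \<open>L\<close>: \<open>k\<close> from the density of
    \<open>I'\<close>, \<open>p\<close> from its doubling \<open>64 * K * L\<close>, the rest from
    the bound on \<open>diffs m A'\<close>.\<close>
  define q where "q = k + (p + 28 * (2 * m) + 12)"
  have C1: "C \<ge> 1"
  proof -
    have "1 * (1 * 1 * 1 * 1) \<le> C"
      unfolding C_def using C0 by (intro mult_mono one_le_power) auto
    then show ?thesis by simp
  qed
  have main: "avg_energy (2 * t) (f ` I) * real (card I) ^ k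
      \<le> C * doubling I ^ p * (avg_energy t (f ` I) * real (card I) ^ k) powr (1 - 1 / real q)"
    if J: "is_interval J" and f: "kconvex_on k J f" and I: "finite I" "I \<noteq> {}" "I \<subseteq> J" and t: "t \<ge> 1" for J f I t
  proof -
    define N where "N = real (card I)"
    define K where "K = doubling I"
    define Q where "Q = avg_energy t (f ` I)"
    define L where "L = Q / avg_energy (2 * t) (f ` I)"
    have N: "N \<ge> 1" using I by (simp add: N_def Suc_leI card_gt_0_iff)
    have K: "K \<ge> 1" using doubling_ge_1 I by (simp add: K_def)
    have fI: "finite (f ` I)" "f ` I \<noteq> {}" using I by auto
    have pos: "Q > 0" "avg_energy (2 * t) (f ` I) > 0"
      using avg_energy_pos[OF fI] by (auto simp: Q_def)
    have L0: "L > 0" using pos by (simp add: L_def)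
    have inj: "inj_on f I" using kconvex_on_inj[OF J f assms] I(3) by (rule inj_on_subset)
    then have cI: "card (f ` I) = card I" by (rule card_image)
    obtain A' where A': "A' \<subseteq> f ` I" "N / (64 * L) \<le> real (card A')"
      "\<And>m. real (card (diffs m A')) \<le> (2 ^ 81 * L ^ 28) ^ (2 * m) * (2 ^ 33 * L ^ 12 / Q)"
      using energy_structure[OF fI t L_def[unfolded Q_def]] unfolding cI N_def Q_def by blast
    define I' where "I' = {x\<in>I. f x \<in> A'}"
    have fI': "f ` I' = A'" using A'(1) by (auto simp: I'_def)
    have I'I: "I' \<subseteq> I" by (auto simp: I'_def)
    have "card A' = card I'"
      unfolding fI'[symmetric] using inj I'I by (intro card_image) (rule inj_on_subset)
    then have cI': "N / (64 * L) \<le> real (card I')" using A'(2) by simp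
    have "N / (64 * L) > 0" using N L0 by simp
    then have n0: "real (card I') > 0" using cI' by linarith
    have finI': "finite I'" "I' \<noteq> {}" using n0 I'I I(1) finite_subset by auto
    have "doubling I' \<le> 64 * K * L"
    proof -
      have "card (two_minus I') \<le> card (two_minus I)"
        using I'I I(1) by (intro card_mono finite_two_minus two_minus_mono)
      then have "doubling I' * real (card I') \<le> K * N"
        using n0 N by (simp add: doubling_def K_def N_def)
      also have "\<dots> \<le> K * (64 * L * real (card I'))"
        using cI' L0 K by (intro mult_left_mono) (auto simp: field_simps)
      finally have "doubling I' * real (card I') \<le> (64 * K * L) * real (card I')" by (simp add: mult_ac)
      then show ?thesis using n0 by simp
    qed
    then have dI': "doubling I' ^ p \<le> (64 * K * L) ^ p"
      by (rule power_mono) (simp add: doubling_def)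
    have "(N / (64 * L)) ^ k \<le> real (card I') ^ k"
      using cI' N L0 by (intro power_mono) auto
    also have "\<dots> \<le> C0 * doubling I' ^ p * real (card (diffs m A'))"
      using sumset[OF J f finI'] I'I I(3) unfolding fI' by blast
    also have "\<dots> \<le> C0 * (64 * K * L) ^ p * ((2 ^ 81 * L ^ 28) ^ (2 * m) * (2 ^ 33 * L ^ 12 / Q))"
      using dI' A'(3)[of m] C0 K L0 by (intro mult_mono mult_left_mono) auto
    finally have "(N / (64 * L)) ^ k * (64 * L) ^ k * Q
        \<le> C0 * (64 * K * L) ^ p * ((2 ^ 81 * L ^ 28) ^ (2 * m) * (2 ^ 33 * L ^ 12 / Q)) * (64 * L) ^ k * Q"
      using L0 pos(1) by (intro mult_right_mono) auto
    also have "(N / (64 * L)) ^ k * (64 * L) ^ k = N ^ k"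
      using L0 by (simp add: power_divide)
    also have "C0 * (64 * K * L) ^ p * ((2 ^ 81 * L ^ 28) ^ (2 * m) * (2 ^ 33 * L ^ 12 / Q)) * (64 * L) ^ k * Q
        = C0 * (64 * K * L) ^ p * ((2 ^ 81 * L ^ 28) ^ (2 * m) * (2 ^ 33 * L ^ 12)) * (64 * L) ^ k"
      using pos(1) by simp
    also have "\<dots> = C * K ^ p * L ^ q"
    proof -
      have "(2 ^ 81 * L ^ 28) ^ (2 * m) = (2 ^ 81) ^ (2 * m) * L ^ (28 * (2 * m))"
        unfolding power_mult_distrib power_mult[of L 28] ..
      then show ?thesis
        unfolding C_def q_def power_add power_mult_distrib by (simp only: mult_ac)
    qed
    finally have *: "Q * N ^ k \<le> C * K ^ p * L ^ q" by (simp only: mult.commute)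
    define X where "X = Q * N ^ k"
    define Y where "Y = avg_energy (2 * t) (f ` I) * N ^ k"
    define B where "B = C * K ^ p"
    have X0: "X > 0" and Y0: "Y > 0" using pos N by (auto simp: X_def Y_def)
    have B1: "B \<ge> 1"
      using mult_mono[OF C1 one_le_power[OF K, of p]] C1 by (simp add: B_def)
    have "L = X / Y" using N by (simp add: X_def Y_def L_def)
    then have "X \<le> B * (X / Y) ^ q" using * by (simp add: X_def B_def)
    then have "X * Y ^ q \<le> B * X ^ q"
      using Y0 by (simp add: power_divide field_simps)
    moreover have "q \<ge> 1" by (simp add: q_def)
    then have Xq: "X ^ q = X ^ (q - 1) * X" by (simp add: power_eq_if)
    ultimately have "Y ^ q \<le> B * X ^ (q - 1)"
      using X0 by (simp add: mult_ac)
    \<comment> \<open>A deliberate loss, so that the \<open>q\<close>-th root leaves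
      \<open>B\<close> and not a fractional power of it.\<close>
    also have "\<dots> \<le> B ^ q * X ^ (q - 1)"
      using B1 \<open>q \<ge> 1\<close> X0 by (intro mult_right_mono) (auto intro: self_le_power)
    also have "X ^ (q - 1) = (X powr (1 - 1 / real q)) ^ q"
    proof -
      have "(X powr (1 - 1 / real q)) ^ q = X powr (real q * (1 - 1 / real q))"
        using X0 by (simp add: powr_realpow[symmetric] powr_powr mult.commute)
      also have "real q * (1 - 1 / real q) = real (q - 1)"
        using \<open>q \<ge> 1\<close> by (simp add: field_simps of_nat_diff)
      finally show ?thesis using X0 by (simp add: powr_realpow)
    qed
    also have "B ^ q * (X powr (1 - 1 / real q)) ^ q = (B * X powr (1 - 1 / real q)) ^ q"
      by (rule power_mult_distrib[symmetric])
    finally have "Y \<le> B * X powr (1 - 1 / real q)"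
      using B1 \<open>q \<ge> 1\<close> by (subst (asm) power_mono_iff) (use Y0 in auto)
    then show ?thesis by (simp add: X_def Y_def B_def Q_def N_def K_def)
  qed
  have "q \<ge> 3" by (simp add: q_def)
  show ?thesis using that[OF C1 \<open>q \<ge> 3\<close> main] .
qed

lemma avg_energy_antimono:
  assumes "finite A" "A \<noteq> {}" "s \<le> t"
  shows "avg_energy t A \<le> avg_energy s A"
  using assms(3)
proof (induction t rule: dec_induct)
  case (step t)
  have N: "real (card A) > 0" using assms by (simp add: card_gt_0_iff)
  have "avg_energy (Suc t) A \<le> (real (card A))\<^sup>2 * real (energy t A) / real (card A) ^ (2 * Suc t)"
    unfolding avg_energy_def by (intro divide_right_mono energy_Suc_le assms) auto
  also have "\<dots> = avg_energy t A"
    using N by (simp add: avg_energy_def power2_eq_square)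
  finally show ?case using step.IH by linarith
qed simp

lemma avg_energy_1:
  assumes "finite A" "A \<noteq> {}"
  shows "avg_energy 1 A = 1 / real (card A)"
  using energy_1[OF assms(1)] assms by (simp add: avg_energy_def power2_eq_square)

theorem theorem1p6:
  fixes k :: nat
  assumes "k \<ge> 2"
  shows "\<exists>\<eta>::real. 0 < \<eta> \<and> \<eta> < 1 \<and>
    (\<forall>s::nat. s \<ge> 1 \<longrightarrow>
      (\<exists>c::real. c > 0 \<and> (\<exists>C::real. C > 0 \<and>
        (\<forall>(J::real set) (f::real \<Rightarrow> real) (I::real set).
           is_interval J \<and> kconvex_on k J f \<and> finite I \<and> I \<noteq> {} \<and> I \<subseteq> J \<longrightarrow>
           real (energy s (f ` I)) \<le>
             C * (real (card (f ` I)) powr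
                    (2 * real s - real k + (4 * real k - 4) * real s powr (- \<eta>))
                  + (real (card (two_minus I)) / real (card I)) powr c)))))"
proof -
  have "k \<ge> 1" using assms by simp
  obtain C :: real and p q :: nat where C: "C \<ge> 1" and q: "q \<ge> 3" and
    double: "\<And>J f I t. is_interval J \<Longrightarrow> kconvex_on k J f \<Longrightarrow> finite I \<Longrightarrow> I \<noteq> {} \<Longrightarrow> I \<subseteq> J \<Longrightarrow> t \<ge> 1 \<Longrightarrow>
      avg_energy (2 * t) (f ` I) * real (card I) ^ k
      \<le> C * doubling I ^ p * (avg_energy t (f ` I) * real (card I) ^ k) powr (1 - 1 / real q)"
    by (rule avg_energy_kconvex_double[OF \<open>k \<ge> 1\<close>]) (rule that)
  define \<theta> where "\<theta> = 1 - 1 / real q"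
  have \<theta>: "1 / 2 < \<theta>" "\<theta> < 1" using q by (auto simp: \<theta>_def field_simps)
  \<comment> \<open>Chosen so that \<open>s powr (- \<eta>) = \<theta> powr log 2 s\<close>. Since
    \<open>q \<ge> 3\<close> puts \<open>\<theta>\<close> above \<open>1 / 2\<close>, this gives
    \<open>\<eta> < 1\<close>.\<close>
  define \<eta> where "\<eta> = - log 2 \<theta>"
  have "log 2 (1 / 2) < log 2 \<theta>" "log 2 \<theta> < log 2 1"
    using \<theta> by (auto simp only: log_less_cancel_iff)
  then have \<eta>: "0 < \<eta>" "\<eta> < 1" by (auto simp: \<eta>_def log_divide)
  \<comment> \<open>The accumulated factor is at least 1, so raising it to the power
    \<open>\<theta> < 1\<close> does not enlarge it; each doubling costs just one more factor
    \<open>C * K ^ p\<close>.\<close>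
  have iter: "avg_energy (2 ^ j) (f ` I) * real (card I) ^ k
      \<le> (C * doubling I ^ p) ^ j * real (card I) powr ((real k - 1) * \<theta> ^ j)"
    if J: "is_interval J" and f: "kconvex_on k J f" and I: "finite I" "I \<noteq> {}" "I \<subseteq> J" for J f I j
  proof (induction j)
    case 0
    have N: "real (card I) > 0" using I by (simp add: card_gt_0_iff)
    have "card (f ` I) = card I"
      using kconvex_on_inj[OF J f \<open>k \<ge> 1\<close>] I(3) by (intro card_image) (rule inj_on_subset)
    then have "avg_energy 1 (f ` I) = 1 / real (card I)"
      using avg_energy_1[of "f ` I"] I by simp
    moreover have "real (card I) powr (real k - 1) = real (card I) ^ k / real (card I)"
      using N by (simp add: powr_diff powr_realpow)
    ultimately show ?case by simp
  next
    case (Suc j)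
    define B where "B = C * doubling I ^ p"
    define N where "N = real (card I)"
    have N: "N > 0" using I by (simp add: N_def card_gt_0_iff)
    have B1: "B \<ge> 1"
      using mult_mono[OF C one_le_power[OF doubling_ge_1[OF I(1,2)], of p]] C by (simp add: B_def)
    have Bj: "B ^ j \<ge> 1" using B1 by (rule one_le_power)
    have X0: "0 \<le> avg_energy (2 ^ j) (f ` I) * N ^ k"
      by (simp add: avg_energy_def N_def)
    have "avg_energy (2 ^ Suc j) (f ` I) * N ^ k \<le> B * (avg_energy (2 ^ j) (f ` I) * N ^ k) powr \<theta>"
      using double[OF J f I, of "2 ^ j"] by (simp add: B_def N_def \<theta>_def)
    also have "\<dots> \<le> B * (B ^ j * N powr ((real k - 1) * \<theta> ^ j)) powr \<theta>"
      using Suc.IH X0 B1 \<theta> by (intro mult_left_mono powr_mono2) (auto simp: B_def N_def)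
    also have "\<dots> = B * ((B ^ j) powr \<theta> * N powr ((real k - 1) * \<theta> ^ Suc j))"
      using N Bj by (simp add: powr_mult powr_powr mult_ac)
    also have "\<dots> \<le> B * (B ^ j * N powr ((real k - 1) * \<theta> ^ Suc j))"
      using powr_mono[of \<theta> 1 "B ^ j"] \<theta> Bj B1 by (intro mult_left_mono mult_right_mono) auto
    finally show ?case by (simp add: B_def N_def mult_ac)
  qed
  show ?thesis
  proof (rule exI[of _ \<eta>], intro conjI \<eta> allI impI)
    fix s :: nat
    assume s: "s \<ge> 1"
    \<comment> \<open>The iteration reaches powers of two only; monotonicity of
      \<open>avg_energy\<close> carries the bound from \<open>2 ^ j\<close> to
      \<open>s\<close>.\<close>
    obtain j where j: "2 ^ j \<le> s" "s < 2 ^ (j + 1)"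
      using ex_power_ivl1[of 2 s] s by auto
    define b where "b = (4 * real k - 4) * real s powr (- \<eta>)"
    define a where "a = (real k - 1) * \<theta> ^ j"
    have b0: "b > 0" using assms s by (simp add: b_def)
    \<comment> \<open>Rounding \<open>log 2 s\<close> up to \<open>j + 1\<close> costs one factor
      \<open>\<theta> > 1 / 2\<close>, hence the 2.\<close>
    have "\<theta> ^ j \<le> 2 * real s powr (- \<eta>)"
    proof -
      have "log 2 (real s) \<le> real (j + 1)"
      proof -
        have "real s \<le> 2 ^ (j + 1)" using j(2) by (metis less_imp_le of_nat_le_iff of_nat_numeral of_nat_power)
        then have "log 2 (real s) \<le> log 2 (2 ^ (j + 1))" using s by (intro log_mono) auto
        also have "\<dots> = real (j + 1)" by (rule log_pow_cancel) auto
        finally show ?thesis .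
      qed
      have "real s powr (- \<eta>) = \<theta> powr log 2 (real s)"
        using s \<theta> by (simp add: \<eta>_def powr_def log_def mult.commute)
      also have "\<dots> \<ge> \<theta> powr real (j + 1)"
        using \<open>log 2 (real s) \<le> real (j + 1)\<close> \<theta> by (intro powr_mono') auto
      finally have "\<theta> * \<theta> ^ j \<le> real s powr (- \<eta>)"
        using \<theta> by (simp add: powr_realpow flip: of_nat_Suc)
      moreover have "1 / 2 * \<theta> ^ j \<le> \<theta> * \<theta> ^ j"
        using \<theta> by (intro mult_right_mono) auto
      ultimately show ?thesis by simp
    qed
    \<comment> \<open>This explains \<open>4 * k - 4\<close>: half of \<open>b\<close> covers the
      exponent \<open>(k - 1) * \<theta> ^ j\<close> after rounding, the other half is reserved for
      the power of \<open>K\<close>.\<close>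
    from mult_left_mono[OF this, of "real k - 1"] have ab: "a \<le> b / 2"
      using assms by (simp add: a_def b_def algebra_simps)
    \<comment> \<open>If \<open>K ^ (p * j)\<close> exceeds \<open>N powr (b / 2)\<close>, raising
      to the power \<open>4 * s / b\<close> bounds \<open>N ^ (2 * s)\<close> by a power of
      \<open>K\<close>. The added 1 keeps \<open>c\<close> positive when
      \<open>p * j = 0\<close>.\<close>
    define c where "c = 4 * real s * real p * real j / b + 1"
    show "\<exists>c>0. \<exists>C>0. \<forall>J f I.
           is_interval J \<and> kconvex_on k J f \<and> finite I \<and> I \<noteq> {} \<and> I \<subseteq> J \<longrightarrow>
           real (energy s (f ` I)) \<le>
             C * (real (card (f ` I)) powr
                    (2 * real s - real k + (4 * real k - 4) * real s powr (- \<eta>))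
                  + (real (card (two_minus I)) / real (card I)) powr c)"
      unfolding b_def[symmetric] doubling_def[symmetric]
    proof (rule exI[of _ c], intro exI[of _ "C ^ j"] conjI allI impI)
      show "c > 0" using b0 by (simp add: c_def add_nonneg_pos)
      show "C ^ j > 0" using C by simp
      fix J :: "real set" and f :: "real \<Rightarrow> real" and I :: "real set"
      assume "is_interval J \<and> kconvex_on k J f \<and> finite I \<and> I \<noteq> {} \<and> I \<subseteq> J"
      then have J: "is_interval J" and f: "kconvex_on k J f" and I: "finite I" "I \<noteq> {}" "I \<subseteq> J"
        by auto
      define N where "N = real (card I)"
      define K where "K = doubling I"
      have N: "N \<ge> 1" using I by (simp add: N_def Suc_leI card_gt_0_iff)
      have K: "K \<ge> 1" using doubling_ge_1 I by (simp add: K_def)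
      have Cj: "C ^ j \<ge> 1" using C by (rule one_le_power)
      have fI: "finite (f ` I)" "f ` I \<noteq> {}" using I by auto
      have cI: "card (f ` I) = card I"
        using kconvex_on_inj[OF J f \<open>k \<ge> 1\<close>] I(3) by (intro card_image) (rule inj_on_subset)
      have E: "real (energy s (f ` I)) = avg_energy s (f ` I) * N ^ (2 * s)"
        using N by (simp add: avg_energy_def cI N_def)
      show "real (energy s (f ` I)) \<le> C ^ j * (real (card (f ` I)) powr (2 * real s - real k + b) + doubling I powr c)"
        unfolding cI N_def[symmetric] K_def[symmetric]
      proof (cases "K ^ (p * j) \<le> N powr (b / 2)")
        case True
        have "avg_energy s (f ` I) * N ^ k \<le> avg_energy (2 ^ j) (f ` I) * N ^ k"
          using N by (intro mult_right_mono avg_energy_antimono[OF fI j(1)]) auto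
        also have "\<dots> \<le> (C * K ^ p) ^ j * N powr a"
          using iter[OF J f I, of j] by (simp add: N_def K_def a_def)
        also have "\<dots> = C ^ j * (K ^ (p * j) * N powr a)"
          by (simp add: power_mult_distrib power_mult)
        also have "\<dots> \<le> C ^ j * (N powr (b / 2) * N powr (b / 2))"
          using True ab N Cj by (intro mult_left_mono mult_mono powr_mono) auto
        also have "\<dots> = C ^ j * N powr b" using N by (simp add: powr_add[symmetric])
        finally have X: "avg_energy s (f ` I) * N ^ k \<le> C ^ j * N powr b" .
        have "N ^ (2 * s) = N ^ k * N powr (2 * real s - real k)"
          using N by (simp add: powr_diff powr_realpow[symmetric])
        then have "real (energy s (f ` I)) = (avg_energy s (f ` I) * N ^ k) * N powr (2 * real s - real k)"
          unfolding E by simp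
        also have "\<dots> \<le> (C ^ j * N powr b) * N powr (2 * real s - real k)"
          using X by (intro mult_right_mono) auto
        also have "\<dots> = C ^ j * N powr (2 * real s - real k + b)"
          using N by (simp add: powr_add)
        also have "\<dots> \<le> C ^ j * (N powr (2 * real s - real k + b) + K powr c)"
          using Cj by (intro mult_left_mono) auto
        finally show "real (energy s (f ` I)) \<le> C ^ j * (N powr (2 * real s - real k + b) + K powr c)" .
      next
        case False
        have "avg_energy s (f ` I) \<le> avg_energy 1 (f ` I)"
          by (rule avg_energy_antimono[OF fI s])
        also have "\<dots> \<le> 1"
          using avg_energy_1[OF fI] N by (simp add: cI N_def)
        finally have "real (energy s (f ` I)) \<le> 1 * N ^ (2 * s)"
          unfolding E using N by (intro mult_right_mono) auto
        also have "\<dots> = (N powr (b / 2)) powr (4 * real s / b)"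
          using N b0 by (simp add: powr_powr powr_realpow[symmetric])
        also have "\<dots> \<le> (K ^ (p * j)) powr (4 * real s / b)"
          using False b0 by (intro powr_mono2) auto
        also have "\<dots> = K powr (c - 1)"
          using K by (simp add: c_def powr_realpow[symmetric] powr_powr mult_ac)
        also have "\<dots> \<le> K powr c" using K by (intro powr_mono) auto
        also have "\<dots> \<le> 1 * (N powr (2 * real s - real k + b) + K powr c)" by simp
        also have "\<dots> \<le> C ^ j * (N powr (2 * real s - real k + b) + K powr c)"
          using Cj by (intro mult_right_mono) auto
        finally show "real (energy s (f ` I)) \<le> C ^ j * (N powr (2 * real s - real k + b) + K powr c)" .
      qed
    qed
  qed
qed

end
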